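(* Assume (h1), (h2) and (h3) (stated in the context), and let $g$ have convex components. If $x\in\mathbb{R}^n$ and $0\le t<T$, then the value function $U(t,x)=\inf_{y\in A(t,x)}J_t(y)$ can be written as $$ U(t,x)=\sup_{\zeta\in C^+\setminus\{0\}}\Bigl(\inf_{p\in\mathbb{R}^n}J_t(Y_{t,x,p,\zeta})+H^+(\zeta)\Bigr). $$
   Context: Let $C\subset\mathbb{R}^d$ be a closed convex cone with nonempty interior and $C^+=\{\zeta\in\mathbb{R}^d : \zeta\cdot z\ge 0\ \forall z\in C\}$. For $\zeta\in C^+\setminus\{0\}$, $H^+(\zeta)=\{z\in\mathbb{R}^d:\zeta\cdot z\ge0\}$. For $A,B\subseteq\mathbb{R}^d$, $A+B$ is the Minkowski sum (with $A+\emptyset=\emptyset$) and $A\oplus B=\mathrm{cl}(A+B)$; a vector added to a set is a translation. $\mathcal{F}(\mathbb{R}^d,C)=\{A\subseteq\mathbb{R}^d : A=A\oplus C\}$, ordered by $\supseteq$, is a complete lattice with $\inf\mathcal{A}=\mathrm{cl}\bigcup_{A\in\mathcal{A}}A$ and $\sup\mathcal{A}=\bigcap_{A\in\mathcal{A}}A$. In the claim, inf and sup are taken in this lattice. Let $T>0$, $L:\mathbb{R}^n\to\mathbb{R}^d$, $g:\mathbb{R}^n\to\mathbb{R}^d$, and let $d_t(s)>0$ ($t\in[0,T]$, $s\in[t,T]$) be a discount factor. For $\zeta\in C^+\setminus\{0\}$ put $L_\zeta(w)=L(w)\cdot\zeta$, $g_\zeta(w)=g(w)\cdot\zeta$. Let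 $B^+$ be a base of $C^+$ (each $\zeta\in C^+\setminus\{0\}$ is uniquely $\lambda\xi$ with $\lambda>0$, $\xi\in B^+$). Hypotheses: (h1) for all $\zeta\in B^+$, $L_\zeta$ is $C^2$, strictly convex and coercive: $\lim_{|w|\to\infty}L_\zeta(w)/|w|=+\infty$ (so $\nabla L_\zeta$ is a homeomorphism of $\mathbb{R}^n$ for every $\zeta\in C^+\setminus\{0\}$); (h2) for all $\zeta\in B^+$, $g_\zeta$ is globally Lipschitz in $\mathbb{R}^n$; (h3) for any $t\in[0,T]$, $d_t:[t,T]\to(a,1]$, with $a>0$, is continuous, and $d_t(t)=1$. Define $\mathcal{L}_t(s,w)=d_t(s)L(w)+C$ for $s\in[t,T]$, $w\in\mathbb{R}^n$. For $y\in W^{1,1}([t,T],\mathbb{R}^n)$ put $J_t(y)=\int_t^T\mathcal{L}_t(s,\dot y(s))\,ds+d_t(T)g(y(T))\in\mathcal{F}(\mathbb{R}^d,C)$ (Aumann integral; by convention $\int_t^tF(s)\,ds=C$). $A(t,x)=\{y\in W^{1,1}([t,T],\mathbb{R}^n): y(t)=x\}$. For $p\in\mathbb{R}^n$, $\zeta\in C^+\setminus\{0\}$, the arc $Y_{t,x,p,\zeta}\in A(t,x)$ is $$Y_{t,x,p,\zeta}(s)=x+\int_t^s(\nabla L_\zeta)^{-1}\Bigl(\frac{p}{d_t(r)}\Bigr)dr .$$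
   Formalization: "g has convex components" is taken to mean that g_ζ = g·ζ is convex for every ζ in B^+ (convexity relative to C); with convex coordinates only, the claim fails for some cones C, e.g. C = -R^2_+, while for C containing the positive orthant convex coordinates suffice. *)

theory Defs
  imports "HOL-Analysis.Analysis"
begin

section \<open>Cones and the lattice of closed upper sets\<close>

text \<open>Minkowski sums \<open>A + B\<close> and translations \<open>v +o B\<close> are those of \<open>Set_Algebras\<close>.\<close>

definition dual_cone :: "'a::real_inner set \<Rightarrow> 'a set" where
  "dual_cone C = {\<zeta>. \<forall>z\<in>C. \<zeta> \<bullet> z \<ge> 0}"

definition Hplus :: "'a::real_inner \<Rightarrow> 'a set" where
  "Hplus \<zeta> = {z. \<zeta> \<bullet> z \<ge> 0}"

definition is_cone_base :: "'a::real_vector set \<Rightarrow> 'a set \<Rightarrow> bool" where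
  "is_cone_base B K \<longleftrightarrow> B \<subseteq> K - {0} \<and>
     (\<forall>\<zeta>\<in>K - {0}. \<exists>!(l, \<xi>). (l::real) > 0 \<and> \<xi> \<in> B \<and> \<zeta> = l *\<^sub>R \<xi>)"

definition oplus :: "'a::real_normed_vector set \<Rightarrow> 'a set \<Rightarrow> 'a set" where
  "oplus A B = closure (A + B)"

definition Fcal :: "'a::real_normed_vector set \<Rightarrow> 'a set set" where
  "Fcal C = {A. A = oplus A C}"

text \<open>Infimum and supremum in \<open>Fcal C\<close> with respect to \<open>\<supseteq>\<close>; in particular the supremum of
  the empty family is the whole space.  The two lemmas below justify the names.\<close>

definition Finf :: "'a::real_normed_vector set set \<Rightarrow> 'a set" where
  "Finf \<A> = closure (\<Union>\<A>)"

definition Fsup :: "'a::real_normed_vector set set \<Rightarrow> 'a set" where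
  "Fsup \<A> = \<Inter>\<A>"

lemma Fcal_iff:
  fixes C :: "'a::real_normed_vector set"
  assumes "0 \<in> C"
  shows "A \<in> Fcal C \<longleftrightarrow> closed A \<and> (\<forall>z\<in>A. \<forall>c\<in>C. z + c \<in> A)"
proof
  assume "A \<in> Fcal C"
  then have A: "closure (A + C) = A" by (simp add: Fcal_def oplus_def)
  have "closed (closure (A + C))" by simp
  moreover have "z + c \<in> closure (A + C)" if "z \<in> A" "c \<in> C" for z c
    by (rule subsetD[OF closure_subset]) (rule set_plus_intro[OF that])
  ultimately show "closed A \<and> (\<forall>z\<in>A. \<forall>c\<in>C. z + c \<in> A)" unfolding A by simp
next
  assume A: "closed A \<and> (\<forall>z\<in>A. \<forall>c\<in>C. z + c \<in> A)"
  have "z \<in> A + C" if "z \<in> A" for z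
    using set_plus_intro[OF that assms] by simp
  moreover have "z \<in> A" if "z \<in> A + C" for z
    using that A by (auto elim!: set_plus_elim)
  ultimately have "A + C = A" by (intro equalityI subsetI)
  with A show "A \<in> Fcal C" by (simp add: Fcal_def oplus_def)
qed

lemma Finf_is_infimum:
  fixes C :: "'a::real_normed_vector set"
  assumes "0 \<in> C" "\<A> \<subseteq> Fcal C"
  shows "Finf \<A> \<in> Fcal C"
    and "A \<in> \<A> \<Longrightarrow> Finf \<A> \<supseteq> A"
    and "G \<in> Fcal C \<Longrightarrow> (\<And>A. A \<in> \<A> \<Longrightarrow> G \<supseteq> A) \<Longrightarrow> G \<supseteq> Finf \<A>"
proof -
  have up: "z + c \<in> \<Union>\<A>" if "z \<in> \<Union>\<A>" "c \<in> C" for z c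
    using that assms(2) Fcal_iff[OF assms(1)] by (meson UnionE UnionI subsetD)
  have "z + c \<in> closure (\<Union>\<A>)" if z: "z \<in> closure (\<Union>\<A>)" and c: "c \<in> C" for z c
  proof -
    from z obtain f where f: "\<forall>n. f n \<in> \<Union>\<A>" "f \<longlonglongrightarrow> z"
      by (meson closure_sequential)
    have "\<forall>n. f n + c \<in> \<Union>\<A>" using f(1) up[OF _ c] by blast
    moreover have "(\<lambda>n. f n + c) \<longlonglongrightarrow> z + c" by (intro tendsto_add f(2) tendsto_const)
    ultimately show ?thesis
      unfolding closure_sequential by (intro exI[of _ "\<lambda>n. f n + c"] conjI)
  qed
  then show "Finf \<A> \<in> Fcal C"
    by (simp add: Fcal_iff[OF assms(1)] Finf_def)
  show "A \<in> \<A> \<Longrightarrow> Finf \<A> \<supseteq> A"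
    unfolding Finf_def by (rule order_trans[OF Union_upper closure_subset])
  show "G \<in> Fcal C \<Longrightarrow> (\<And>A. A \<in> \<A> \<Longrightarrow> G \<supseteq> A) \<Longrightarrow> G \<supseteq> Finf \<A>"
    unfolding Finf_def by (rule closure_minimal) (auto simp: Fcal_iff[OF assms(1)])
qed

lemma Fsup_is_supremum:
  fixes C :: "'a::real_normed_vector set"
  assumes "0 \<in> C" "\<A> \<subseteq> Fcal C"
  shows "Fsup \<A> \<in> Fcal C"
    and "A \<in> \<A> \<Longrightarrow> A \<supseteq> Fsup \<A>"
    and "(\<And>A. A \<in> \<A> \<Longrightarrow> A \<supseteq> G) \<Longrightarrow> Fsup \<A> \<supseteq> G"
proof -
  have A: "closed A \<and> (\<forall>z\<in>A. \<forall>c\<in>C. z + c \<in> A)" if "A \<in> \<A>" for A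
    using that assms(2) Fcal_iff[OF assms(1)] by (meson subsetD)
  then have "closed (\<Inter>\<A>)" "\<forall>z\<in>\<Inter>\<A>. \<forall>c\<in>C. z + c \<in> \<Inter>\<A>"
    by (auto intro: closed_Inter)
  then show "Fsup \<A> \<in> Fcal C"
    by (simp add: Fcal_iff[OF assms(1)] Fsup_def)
  show "A \<in> \<A> \<Longrightarrow> A \<supseteq> Fsup \<A>"
    unfolding Fsup_def by (rule Inter_lower)
  show "(\<And>A. A \<in> \<A> \<Longrightarrow> A \<supseteq> G) \<Longrightarrow> Fsup \<A> \<supseteq> G"
    unfolding Fsup_def by (rule Inter_greatest)
qed

section \<open>Smoothness, strict convexity, coercivity\<close>

definition gradient :: "('a::real_inner \<Rightarrow> real) \<Rightarrow> 'a \<Rightarrow> 'a" where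
  "gradient f x = (THE D. GDERIV f x :> D)"

definition C2_function :: "('a::real_inner \<Rightarrow> real) \<Rightarrow> bool" where
  "C2_function f \<longleftrightarrow>
     (\<exists>G (H :: 'a \<Rightarrow> 'a \<Rightarrow>\<^sub>L 'a). (\<forall>x. GDERIV f x :> G x) \<and>
        (\<forall>x. (G has_derivative blinfun_apply (H x)) (at x)) \<and> continuous_on UNIV H)"

definition strictly_convex :: "('a::real_vector \<Rightarrow> real) \<Rightarrow> bool" where
  "strictly_convex f \<longleftrightarrow>
     (\<forall>x y u. x \<noteq> y \<longrightarrow> 0 < u \<longrightarrow> u < 1 \<longrightarrow>
        f ((1 - u) *\<^sub>R x + u *\<^sub>R y) < (1 - u) * f x + u * f y)"

definition coercive :: "('a::real_normed_vector \<Rightarrow> real) \<Rightarrow> bool" where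
  "coercive f \<longleftrightarrow> filterlim (\<lambda>w. f w / norm w) at_top at_infinity"

section \<open>The Sobolev space \<open>W\<^sup>1\<^sup>,\<^sup>1([a, b])\<close>\<close>

definition test_function :: "real \<Rightarrow> real \<Rightarrow> (real \<Rightarrow> real) \<Rightarrow> bool" where
  "test_function a b \<phi> \<longleftrightarrow>
     \<phi> C1_differentiable_on UNIV \<and> closure {s. \<phi> s \<noteq> 0} \<subseteq> {a<..<b}"

definition has_weak_deriv ::
    "(real \<Rightarrow> 'a::euclidean_space) \<Rightarrow> (real \<Rightarrow> 'a) \<Rightarrow> real \<Rightarrow> real \<Rightarrow> bool" where
  "has_weak_deriv y v a b \<longleftrightarrow>
     v absolutely_integrable_on {a..b} \<and>
     (\<forall>\<phi>. test_function a b \<phi> \<longrightarrow>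
        integral {a..b} (\<lambda>s. deriv \<phi> s *\<^sub>R y s) = - integral {a..b} (\<lambda>s. \<phi> s *\<^sub>R v s))"

text \<open>Elements of \<open>W11 a b\<close> are given by their continuous representatives, so that the point
  values \<open>y a\<close> and \<open>y b\<close> make sense.  An arc is a function on all of the real line of which
  only the restriction to \<open>{a..b}\<close> matters.\<close>

definition W11 :: "real \<Rightarrow> real \<Rightarrow> (real \<Rightarrow> 'a::euclidean_space) set" where
  "W11 a b = {y. continuous_on {a..b} y \<and> (\<exists>v. has_weak_deriv y v a b)}"

text \<open>The weak derivative is determined up to a null set only; one representative is chosen.\<close>

definition weak_deriv :: "real \<Rightarrow> real \<Rightarrow> (real \<Rightarrow> 'a::euclidean_space) \<Rightarrow> real \<Rightarrow> 'a" where
  "weak_deriv a b y = (SOME v. has_weak_deriv y v a b)"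

section \<open>The set-valued control problem\<close>

text \<open>Aumann integral: the set of integrals of integrable selections.  By convention
  the integral over a degenerate interval is the cone \<open>C\<close>.\<close>

definition aumann_integral ::
    "'a::euclidean_space set \<Rightarrow> real \<Rightarrow> real \<Rightarrow> (real \<Rightarrow> 'a set) \<Rightarrow> 'a set" where
  "aumann_integral C a b F =
     (if a = b then C
      else {integral {a..b} f | f. f absolutely_integrable_on {a..b} \<and>
                                   (AE s in lebesgue_on {a..b}. f s \<in> F s)})"

definition Lset ::
    "'b::euclidean_space set \<Rightarrow> (real \<Rightarrow> real \<Rightarrow> real) \<Rightarrow> ('a \<Rightarrow> 'b) \<Rightarrow>
     real \<Rightarrow> real \<Rightarrow> 'a \<Rightarrow> 'b set" where
  "Lset C d L t s w = (d t s *\<^sub>R L w) +o C"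

definition Jfun ::
    "'b::euclidean_space set \<Rightarrow> real \<Rightarrow> (real \<Rightarrow> real \<Rightarrow> real) \<Rightarrow>
     ('a::euclidean_space \<Rightarrow> 'b) \<Rightarrow> ('a \<Rightarrow> 'b) \<Rightarrow> real \<Rightarrow> (real \<Rightarrow> 'a) \<Rightarrow> 'b set" where
  "Jfun C T d L g t y =
     (d t T *\<^sub>R g (y T)) +o
       aumann_integral C t T (\<lambda>s. Lset C d L t s (weak_deriv t T y s))"

definition admissible :: "real \<Rightarrow> real \<Rightarrow> 'a::euclidean_space \<Rightarrow> (real \<Rightarrow> 'a) set" where
  "admissible T t x = {y \<in> W11 t T. y t = x}"

definition value_function ::
    "'b::euclidean_space set \<Rightarrow> real \<Rightarrow> (real \<Rightarrow> real \<Rightarrow> real) \<Rightarrow>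
     ('a::euclidean_space \<Rightarrow> 'b) \<Rightarrow> ('a \<Rightarrow> 'b) \<Rightarrow> real \<Rightarrow> 'a \<Rightarrow> 'b set" where
  "value_function C T d L g t x = Finf (Jfun C T d L g t ` admissible T t x)"

definition scalarize :: "('a \<Rightarrow> 'b::real_inner) \<Rightarrow> 'b \<Rightarrow> 'a \<Rightarrow> real" where
  "scalarize f \<zeta> w = f w \<bullet> \<zeta>"

definition Yarc ::
    "(real \<Rightarrow> real \<Rightarrow> real) \<Rightarrow> ('a::euclidean_space \<Rightarrow> 'b::euclidean_space) \<Rightarrow>
     real \<Rightarrow> 'a \<Rightarrow> 'a \<Rightarrow> 'b \<Rightarrow> real \<Rightarrow> 'a" where
  "Yarc d L t x p \<zeta> s =
     x + integral {t..s} (\<lambda>r. inv (gradient (scalarize L \<zeta>)) (p /\<^sub>R d t r))"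

end

theory Submission
  imports Defs
begin

text \<open>
  The value set \<open>U\<close>, the closure of the union of all \<open>J y\<close>, is convex and stable under adding
  elements of \<open>C\<close>.  Hence it is an intersection of closed half-spaces, and only normals \<open>\<zeta>\<close> in the
  dual cone occur.  The formula holds because each of these half-spaces is already determined by
  the arcs \<open>Y\<close> with normal \<open>\<zeta>\<close>: among all points of \<open>U\<close> the functional \<open>\<zeta>\<close> is smallest at some point
  \<open>z\<^sub>0\<close> of \<open>J Y\<close> for a suitable costate \<open>p\<close> (lemma \<open>Yarc_point_minimal\<close>), so that adding the half-space
  \<open>Hplus \<zeta>\<close> to the infimum over \<open>p\<close> covers \<open>U\<close>.  In the other direction, a point outside \<open>U\<close> is strictly
  separated from \<open>U\<close> by some \<open>\<zeta>\<close> (\<open>separate_from_upper_set\<close>), in particular from the part of \<open>U\<close> swept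
  out by the arcs with normal \<open>\<zeta>\<close>, and adding \<open>Hplus \<zeta>\<close> does not undo the separation.  Convexity of \<open>U\<close>
  (\<open>convex_Union_J\<close>) is where the convexity of the scalarizations of \<open>g\<close> enters.

  The minimizing costate comes from a scalar variational problem for \<open>f = L\<^sub>\<zeta>\<close>: minimize
  \<open>\<integral> \<delta> f(v) + G(\<integral> v)\<close> over integrable velocities \<open>v\<close>.  The velocity of the arc with costate \<open>p\<close>
  solves the Euler-Lagrange equation \<open>\<delta> \<nabla>f(v) = p\<close>.  Since \<open>p\<close> does not depend on time,
  integrating the tangent inequality of \<open>f\<close> shows that this arc is cheapest among all arcs with the same
  displacement (\<open>running_cost_le\<close>).  Every displacement is reached: the displacement as a function of
  \<open>p\<close> is continuous and points outward on large spheres, so that Brouwer's theorem applies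
  (\<open>surj_displacement\<close>).  What is left is to minimize a continuous function of \<open>p\<close>, and this
  function tends to infinity because the superlinear growth of \<open>f\<close> beats the Lipschitz function \<open>G\<close>
  (\<open>total_cost_at_top\<close>).

  Two points need care.  The functional \<open>J\<close> uses an unspecified representative of the weak derivative;
  weak derivatives are therefore shown to be unique almost everywhere and to integrate to increments.
  And \<open>L\<close> is regular only when paired with the dual cone, so that \<open>L(w)\<close> need not be measurable along
  the lineality space of \<open>C\<close>; integrable selections are built from a continuous map that has the same
  pairings with the dual cone.
\<close>

section \<open>Weak derivatives of continuous arcs\<close>

lemma pos_part_square_deriv:
  "((\<lambda>s::real. (max 0 s)\<^sup>2) has_real_derivative 2 * max 0 s) (at s)"
proof (cases s "0::real" rule: linorder_cases)
  case less
  have "((\<lambda>s::real. 0) has_real_derivative 0) (at s)" by simp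
  moreover have "\<forall>\<^sub>F r in nhds s. (0::real) = (max 0 r)\<^sup>2"
    using order_tendstoD(2)[OF tendsto_ident_at less] eventually_nhds_in_open[of "{..<0}" s] less
    by (auto elim!: eventually_mono)
  ultimately show ?thesis using less by (subst (asm) DERIV_cong_ev) auto
next
  case equal
  have "((\<lambda>h. (max 0 h)\<^sup>2 / h) \<longlongrightarrow> 0) (at (0::real))"
  proof (rule Lim_null_comparison[where g="\<lambda>h. \<bar>h\<bar>"])
    show "\<forall>\<^sub>F h in at (0::real). norm ((max 0 h)\<^sup>2 / h) \<le> \<bar>h\<bar>"
      by (intro always_eventually) (auto simp: max_def power2_eq_square)
    show "((\<lambda>h::real. \<bar>h\<bar>) \<longlongrightarrow> 0) (at 0)" by (intro tendsto_eq_intros) auto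
  qed
  then show ?thesis using equal by (simp add: DERIV_def)
next
  case greater
  have "((\<lambda>s::real. s\<^sup>2) has_real_derivative 2 * s) (at s)"
    by (auto intro!: derivative_eq_intros)
  moreover have "\<forall>\<^sub>F r in nhds s. r\<^sup>2 = (max 0 r)\<^sup>2"
    using eventually_nhds_in_open[of "{0<..}" s] greater by (auto elim!: eventually_mono)
  ultimately show ?thesis using greater by (subst (asm) DERIV_cong_ev) auto
qed

text \<open>The difference of two such ramps, one near each endpoint, is a continuously differentiable cutoff of
  an interval.\<close>

lemma smooth_ramp:
  fixes c e :: real
  assumes "c < e"
  obtains \<sigma> k where "\<And>s. (\<sigma> has_real_derivative k s) (at s)" "continuous_on UNIV k"
    "\<And>s. 0 \<le> k s" "\<And>s. 0 \<le> \<sigma> s" "\<And>s. \<sigma> s \<le> 1"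
    "\<And>s. s \<le> c \<Longrightarrow> \<sigma> s = 0" "\<And>s. e \<le> s \<Longrightarrow> \<sigma> s = 1" "\<And>s. s \<notin> {c..e} \<Longrightarrow> k s = 0"
proof -
  define h where "h = e - c"
  have h: "h > 0" using assms by (simp add: h_def)
  define q where "q s = (max 0 s)\<^sup>2" for s :: real
  \<comment> \<open>The second difference of the squared positive part has a tent as derivative, which is
    nonnegative, continuous and of integral \<open>1\<close>.\<close>
  define \<sigma> where "\<sigma> s = 2 * q ((s - c) / h) - 4 * q ((s - c) / h - 1/2) + 2 * q ((s - c) / h - 1)" for s
  define k where "k s = (4 * max 0 ((s - c) / h) - 8 * max 0 ((s - c) / h - 1/2)
       + 4 * max 0 ((s - c) / h - 1)) / h" for s
  have q: "(q has_real_derivative 2 * max 0 s) (at s)" for s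
    unfolding q_def by (rule pos_part_square_deriv)
  have d: "(\<sigma> has_real_derivative k s) (at s)" for s
    unfolding \<sigma>_def[abs_def] k_def using h
    by (auto intro!: derivative_eq_intros DERIV_chain2[OF q] simp: field_simps)
  have kn: "0 \<le> k s" for s
  proof -
    define r where "r = (s - c) / h"
    show ?thesis unfolding k_def r_def[symmetric] using h
      by (intro divide_nonneg_pos) (auto simp: max_def)
  qed
  have s0: "\<sigma> s = 0" if "s \<le> c" for s
    using that h unfolding \<sigma>_def q_def by (auto simp: max_def field_simps)
  have s1: "\<sigma> s = 1" if "s \<ge> e" for s
  proof -
    have 1: "(s - c) / h \<ge> 1" using that h by (simp add: h_def field_simps)
    define r where "r = (s - c) / h"
    have "r \<ge> 1" using 1 by (simp add: r_def)
    then show ?thesis unfolding \<sigma>_def q_def r_def[symmetric]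
      by (simp add: max_def power2_eq_square algebra_simps)
  qed
  have mono: "\<sigma> r \<le> \<sigma> s" if "r \<le> s" for r s
    using DERIV_nonneg_imp_nondecreasing[OF that, of \<sigma>] d kn by blast
  show ?thesis
  proof
    show "(\<sigma> has_real_derivative k s) (at s)" "0 \<le> k s" for s by (rule d kn)+
    show "continuous_on UNIV k" unfolding k_def[abs_def] by (intro continuous_intros) (use h in auto)
    show "0 \<le> \<sigma> s" for s using s0[of "min s c"] mono[of "min s c" s] by simp
    show "\<sigma> s \<le> 1" for s using s1[of "max s e"] mono[of s "max s e"] by simp
    show "k s = 0" if out: "s \<notin> {c..e}" for s
    proof -
      consider "s < c" | "s > e" using out by (auto simp: not_le)
      then show ?thesis
      proof cases
        case 1 then show ?thesis using h by (simp add: k_def max_def field_simps)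
      next
        case 2 
        define r where "r = (s - c) / h"
        have "r > 1" using 2 h by (simp add: r_def h_def field_simps)
        then show ?thesis unfolding k_def r_def[symmetric] by (simp add: max_def)
      qed
    qed
  qed (use s0 s1 in auto)
qed

text \<open>The derivative of a cutoff that rises from \<open>0\<close> to \<open>1\<close> near an endpoint is an approximate point mass
  at that endpoint; this recovers the boundary values of \<open>y\<close> from the weak formulation.\<close>

lemma concentrating_kernel_limit:
  fixes y :: "real \<Rightarrow> 'a::euclidean_space" and k :: "nat \<Rightarrow> real \<Rightarrow> real"
  assumes y: "continuous_on {a..b} y"
    and k: "\<And>n. continuous_on {a..b} (k n)" "\<And>n s. 0 \<le> k n s" "\<And>n. integral {a..b} (k n) = 1"
    and supp: "\<And>n s. s \<notin> {c n..e n} \<Longrightarrow> k n s = 0"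
    and lim: "c \<longlonglongrightarrow> l" "e \<longlonglongrightarrow> l" and l: "l \<in> {a..b}"
  shows "(\<lambda>n. integral {a..b} (\<lambda>s. k n s *\<^sub>R y s)) \<longlonglongrightarrow> y l"
proof (rule LIMSEQ_I)
  fix r :: real assume r: "0 < r"
  have "continuous (at l within {a..b}) y" using y l by (simp add: continuous_on_eq_continuous_within)
  then obtain \<delta> where \<delta>: "\<delta> > 0" "\<And>s. s \<in> {a..b} \<Longrightarrow> dist s l < \<delta> \<Longrightarrow> dist (y s) (y l) < r/2"
    unfolding continuous_within_eps_delta using r by (metis half_gt_zero)
  have "\<forall>\<^sub>F n in sequentially. dist (c n) l < \<delta>" "\<forall>\<^sub>F n in sequentially. dist (e n) l < \<delta>"
    using lim \<delta>(1) by (auto simp: tendsto_iff)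
  then have "\<forall>\<^sub>F n in sequentially. dist (c n) l < \<delta> \<and> dist (e n) l < \<delta>" by eventually_elim simp
  moreover have "norm (integral {a..b} (\<lambda>s. k n s *\<^sub>R y s) - y l) < r"
    if n: "dist (c n) l < \<delta> \<and> dist (e n) l < \<delta>" for n
  proof -
    have i1: "(\<lambda>s. k n s *\<^sub>R y s) integrable_on {a..b}"
      by (intro integrable_continuous_real continuous_intros k y)
    have i2: "k n integrable_on {a..b}" by (intro integrable_continuous_real k)
    have i3: "((\<lambda>s. k n s *\<^sub>R y l) has_integral 1 *\<^sub>R y l) {a..b}"
      using has_integral_scaleR_left[OF integrable_integral[OF i2], of "y l"] k(3)[of n] by simp
    have "integral {a..b} (\<lambda>s. k n s *\<^sub>R y s) - y l = integral {a..b} (\<lambda>s. k n s *\<^sub>R y s - k n s *\<^sub>R y l)"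
      using integral_diff[OF i1 has_integral_integrable[OF i3]] integral_unique[OF i3] by simp
    also have "norm \<dots> \<le> integral {a..b} (\<lambda>s. k n s * (r/2))"
    proof (rule integral_norm_bound_integral)
      show "(\<lambda>s. k n s *\<^sub>R y s - k n s *\<^sub>R y l) integrable_on {a..b}"
        by (intro integrable_diff i1 has_integral_integrable[OF i3])
      show "(\<lambda>s. k n s * (r/2)) integrable_on {a..b}" by (intro integrable_on_mult_left i2)
      fix s assume s: "s \<in> {a..b}"
      have "norm (k n s *\<^sub>R y s - k n s *\<^sub>R y l) = k n s * dist (y s) (y l)"
        using k(2)[of n s] by (simp add: dist_norm flip: scaleR_diff_right)
      also have "\<dots> \<le> k n s * (r/2)"
      proof (cases "s \<in> {c n..e n}")
        case True
        then have "dist s l < \<delta>" using n by (auto simp: dist_real_def)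
        then show ?thesis using \<delta>(2)[OF s] k(2)[of n s] by (intro mult_left_mono) auto
      qed (simp add: supp)
      finally show "norm (k n s *\<^sub>R y s - k n s *\<^sub>R y l) \<le> k n s * (r/2)" .
    qed
    also have "\<dots> = r/2" using k(3)[of n] by simp
    finally show ?thesis using r by simp
  qed
  ultimately show "\<exists>no. \<forall>n\<ge>no. norm (integral {a..b} (\<lambda>s. k n s *\<^sub>R y s) - y l) < r"
    unfolding eventually_sequentially by blast
qed

lemma absolutely_integrable_continuous_scaleR:
  fixes v :: "real \<Rightarrow> 'a::euclidean_space"
  assumes \<phi>: "continuous_on {a..b} \<phi>" and v: "v absolutely_integrable_on {a..b}"
  shows "(\<lambda>s. \<phi> s *\<^sub>R v s) absolutely_integrable_on {a..b}"
proof (rule absolutely_integrable_bounded_measurable_product[where h="(*\<^sub>R)"])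
  show "bilinear ((*\<^sub>R) :: real \<Rightarrow> 'a \<Rightarrow> 'a)"
    by (auto simp: bilinear_def linear_iff algebra_simps)
  show "\<phi> \<in> borel_measurable (lebesgue_on {a..b})"
    by (intro continuous_imp_measurable_on_sets_lebesgue \<phi>) simp
  show "bounded (\<phi> ` {a..b})"
    by (intro compact_imp_bounded compact_continuous_image \<phi> compact_Icc)
qed (simp, rule v)

text \<open>Test the weak derivative with cutoffs that converge to the indicator of the open interval.  Their derivatives concentrate at the two endpoints, while the integral against \<open>v\<close>
  converges by dominated convergence.\<close>

lemma has_weak_deriv_increment:
  fixes y v :: "real \<Rightarrow> 'a::euclidean_space"
  assumes v: "has_weak_deriv y v a b" and y: "continuous_on {a..b} y" and ab: "a < b"
  shows "integral {a..b} v = y b - y a"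
proof -
  \<comment> \<open>The factor \<open>1/4\<close> keeps the rising ramp on \<open>[a + \<epsilon>, a + 2\<epsilon>]\<close> to the left of the falling
    ramp on \<open>[b - 2\<epsilon>, b - \<epsilon>]\<close>.\<close>
  define \<epsilon> where "\<epsilon> n = (b - a) / 4 * inverse (real (Suc n))" for n
  have \<epsilon>: "0 < \<epsilon> n" "4 * \<epsilon> n \<le> b - a" for n
  proof -
    have "inverse (real (Suc n)) \<le> 1" by (simp add: inverse_eq_divide)
    then have "(b - a) * inverse (real (Suc n)) \<le> (b - a) * 1" using ab by (intro mult_left_mono) auto
    then show "0 < \<epsilon> n" "4 * \<epsilon> n \<le> b - a" using ab by (auto simp: \<epsilon>_def)
  qed
  have \<epsilon>0: "\<epsilon> \<longlonglongrightarrow> 0" unfolding \<epsilon>_def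
    using tendsto_mult_right_zero[OF LIMSEQ_inverse_real_of_nat] by blast
  define ok where "ok c e \<sigma> k \<longleftrightarrow> (\<forall>s. (\<sigma> has_real_derivative k s) (at s)) \<and> continuous_on UNIV k
    \<and> (\<forall>s. 0 \<le> k s) \<and> (\<forall>s. 0 \<le> \<sigma> s) \<and> (\<forall>s. \<sigma> s \<le> 1) \<and> (\<forall>s\<le>c. \<sigma> s = 0) \<and> (\<forall>s\<ge>e. \<sigma> s = 1)
    \<and> (\<forall>s. s \<notin> {c..e} \<longrightarrow> k s = 0)" for c e :: real and \<sigma> k :: "real \<Rightarrow> real"
  have ex: "\<exists>\<sigma> k. ok c e \<sigma> k" if "c < e" for c e
    using smooth_ramp[OF that] unfolding ok_def by metis
  have "\<exists>\<sigma> k. ok (a + \<epsilon> n) (a + 2 * \<epsilon> n) \<sigma> k" for n using \<epsilon>(1)[of n] by (intro ex) auto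
  then obtain \<sigma>1 k1 where 1: "\<And>n. ok (a + \<epsilon> n) (a + 2 * \<epsilon> n) (\<sigma>1 n) (k1 n)" by metis
  have "\<exists>\<sigma> k. ok (b - 2 * \<epsilon> n) (b - \<epsilon> n) \<sigma> k" for n using \<epsilon>(1)[of n] by (intro ex) auto
  then obtain \<sigma>2 k2 where 2: "\<And>n. ok (b - 2 * \<epsilon> n) (b - \<epsilon> n) (\<sigma>2 n) (k2 n)" by metis
  have c: "continuous_on {a..b} (k1 n)" "continuous_on {a..b} (k2 n)" for n
    using 1[of n] 2[of n] by (auto simp: ok_def intro: continuous_on_subset)
  have I: "integral {a..b} k = 1" if "ok c e \<sigma> k" "a \<le> c" "e \<le> b" for c e \<sigma> k
  proof -
    have "(k has_integral \<sigma> b - \<sigma> a) {a..b}"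
    proof (rule fundamental_theorem_of_calculus)
      show "a \<le> b" using ab by simp
      show "(\<sigma> has_vector_derivative k s) (at s within {a..b})" for s
        using that(1) by (auto simp: ok_def has_real_derivative_iff_has_vector_derivative
            intro: has_vector_derivative_at_within)
    qed
    then show ?thesis using that by (auto simp: ok_def)
  qed
  have l1: "(\<lambda>n. integral {a..b} (\<lambda>s. k1 n s *\<^sub>R y s)) \<longlonglongrightarrow> y a"
  proof (rule concentrating_kernel_limit[OF y c(1)])
    show "integral {a..b} (k1 n) = 1" for n by (rule I[OF 1]) (use \<epsilon>[of n] in auto)
    show "0 \<le> k1 n s" for n s using 1[of n] by (simp add: ok_def)
    show "k1 n s = 0" if "s \<notin> {a + \<epsilon> n..a + 2 * \<epsilon> n}" for n s using 1[of n] that by (simp add: ok_def)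
    show "(\<lambda>n. a + \<epsilon> n) \<longlonglongrightarrow> a" "(\<lambda>n. a + 2 * \<epsilon> n) \<longlonglongrightarrow> a"
      by (rule tendsto_eq_intros \<epsilon>0 | simp)+
  qed (use ab in auto)
  have l2: "(\<lambda>n. integral {a..b} (\<lambda>s. k2 n s *\<^sub>R y s)) \<longlonglongrightarrow> y b"
  proof (rule concentrating_kernel_limit[OF y c(2)])
    show "integral {a..b} (k2 n) = 1" for n by (rule I[OF 2]) (use \<epsilon>[of n] in auto)
    show "0 \<le> k2 n s" for n s using 2[of n] by (simp add: ok_def)
    show "k2 n s = 0" if "s \<notin> {b - 2 * \<epsilon> n..b - \<epsilon> n}" for n s using 2[of n] that by (simp add: ok_def)
    show "(\<lambda>n. b - 2 * \<epsilon> n) \<longlonglongrightarrow> b" "(\<lambda>n. b - \<epsilon> n) \<longlonglongrightarrow> b"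
      by (rule tendsto_eq_intros \<epsilon>0 | simp)+
  qed (use ab in auto)
  define \<phi> where "\<phi> n s = \<sigma>1 n s - \<sigma>2 n s" for n s
  have d\<phi>: "(\<phi> n has_real_derivative k1 n s - k2 n s) (at s)" for n s
    unfolding \<phi>_def[abs_def] using 1[of n] 2[of n] by (auto simp: ok_def intro!: derivative_intros)
  have supp: "\<phi> n s = 0" if "s \<notin> {a + \<epsilon> n..b - \<epsilon> n}" for n s
  proof (cases "s < a + \<epsilon> n")
    case True
    then have "s \<le> b - 2 * \<epsilon> n" using \<epsilon>[of n] by linarith
    then show ?thesis using 1[of n] 2[of n] True by (simp add: ok_def \<phi>_def)
  next
    case False
    then have s: "s \<ge> b - \<epsilon> n" using that by auto
    then have "s \<ge> a + 2 * \<epsilon> n" using \<epsilon>[of n] by linarith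
    then show ?thesis using 1[of n] 2[of n] s by (simp add: ok_def \<phi>_def)
  qed
  have test: "test_function a b (\<phi> n)" for n
    unfolding test_function_def
  proof
    have "continuous_on UNIV (\<lambda>s. k1 n s - k2 n s)"
      using 1[of n] 2[of n] by (auto simp: ok_def intro!: continuous_intros)
    then show "\<phi> n C1_differentiable_on UNIV"
      unfolding C1_differentiable_on_def using d\<phi>[of n]
      by (intro exI[of _ "\<lambda>s. k1 n s - k2 n s"])
         (auto simp: has_real_derivative_iff_has_vector_derivative)
    have "closure {s. \<phi> n s \<noteq> 0} \<subseteq> {a + \<epsilon> n..b - \<epsilon> n}"
      using supp[of _ n] by (intro closure_minimal) (blast, simp)
    then show "closure {s. \<phi> n s \<noteq> 0} \<subseteq> {a<..<b}" using \<epsilon>(1)[of n] by auto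
  qed
  have vint: "v absolutely_integrable_on {a..b}" using v by (simp add: has_weak_deriv_def)
  have eq: "integral {a..b} (\<lambda>s. k1 n s *\<^sub>R y s) - integral {a..b} (\<lambda>s. k2 n s *\<^sub>R y s)
      = - integral {a..b} (\<lambda>s. \<phi> n s *\<^sub>R v s)" for n
  proof -
    have "deriv (\<phi> n) = (\<lambda>s. k1 n s - k2 n s)" using DERIV_imp_deriv[OF d\<phi>] by blast
    then have "integral {a..b} (\<lambda>s. (k1 n s - k2 n s) *\<^sub>R y s) = - integral {a..b} (\<lambda>s. \<phi> n s *\<^sub>R v s)"
      using v test[of n] unfolding has_weak_deriv_def by metis
    moreover have "integral {a..b} (\<lambda>s. (k1 n s - k2 n s) *\<^sub>R y s)
        = integral {a..b} (\<lambda>s. k1 n s *\<^sub>R y s) - integral {a..b} (\<lambda>s. k2 n s *\<^sub>R y s)"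
      unfolding scaleR_diff_left
      by (intro integral_diff integrable_continuous_real continuous_intros c y)
    ultimately show ?thesis by simp
  qed
  have cphi: "continuous_on S (\<phi> n)" for n S
    using d\<phi>[of n] by (meson DERIV_isCont continuous_at_imp_continuous_on)
  have le1: "\<bar>\<phi> n s\<bar> \<le> 1" for n s
    using 1[of n] 2[of n] by (simp add: ok_def \<phi>_def abs_le_iff) (smt (verit))
  have l3: "(\<lambda>n. integral {a..b} (\<lambda>s. \<phi> n s *\<^sub>R v s)) \<longlonglongrightarrow> integral {a..b} (\<lambda>s. if s \<in> {a<..<b} then v s else 0)"
  proof (rule dominated_convergence(2)[where h="\<lambda>s. norm (v s)"])
    show "(\<lambda>s. \<phi> n s *\<^sub>R v s) integrable_on {a..b}" for n
      using absolutely_integrable_continuous_scaleR[OF cphi vint]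
      by (simp add: absolutely_integrable_on_def)
    show "(\<lambda>s. norm (v s)) integrable_on {a..b}" using vint by (simp add: absolutely_integrable_on_def)
    show "norm (\<phi> n s *\<^sub>R v s) \<le> norm (v s)" for n s
      using le1[of n s] by (simp add: mult_left_le_one_le)
    fix s assume s: "s \<in> {a..b}"
    show "(\<lambda>n. \<phi> n s *\<^sub>R v s) \<longlonglongrightarrow> (if s \<in> {a<..<b} then v s else 0)"
    proof (cases "s \<in> {a<..<b}")
      case True
      have "\<forall>\<^sub>F n in sequentially. 2 * \<epsilon> n < min (s - a) (b - s)"
        by (rule order_tendstoD(2)[OF tendsto_mult_right_zero[OF \<epsilon>0]]) (use True in auto)
      then have "\<forall>\<^sub>F n in sequentially. \<phi> n s *\<^sub>R v s = v s"
      proof eventually_elim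
        case (elim n)
        have "\<sigma>1 n s = 1" "\<sigma>2 n s = 0" using 1[of n] 2[of n] elim by (auto simp: ok_def)
        then show ?case by (simp add: \<phi>_def)
      qed
      then show ?thesis using True by (simp add: tendsto_eventually)
    next
      case False
      then have "\<phi> n s = 0" for n using \<epsilon>(1)[of n] s by (intro supp) auto
      then have "(\<lambda>n. \<phi> n s *\<^sub>R v s) = (\<lambda>n. 0)" by simp
      with False show ?thesis by (simp only: if_False tendsto_const)
    qed
  qed
  have "integral {a..b} (\<lambda>s. if s \<in> {a<..<b} then v s else 0) = integral {a..b} v"
    by (rule integral_spike[of "{a,b}"]) auto
  with l3 have "(\<lambda>n. - integral {a..b} (\<lambda>s. \<phi> n s *\<^sub>R v s)) \<longlonglongrightarrow> - integral {a..b} v"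
    by (simp add: tendsto_minus)
  moreover have "(\<lambda>n. - integral {a..b} (\<lambda>s. \<phi> n s *\<^sub>R v s)) \<longlonglongrightarrow> y a - y b"
    unfolding eq[symmetric] by (intro tendsto_diff l1 l2)
  ultimately have "- integral {a..b} v = y a - y b" by (rule LIMSEQ_unique)
  then show ?thesis by (metis minus_diff_eq minus_equation_iff)
qed

lemma test_function_C1_deriv:
  assumes "test_function a b \<phi>"
  shows "(\<phi> has_real_derivative deriv \<phi> s) (at s)" "continuous_on UNIV (deriv \<phi>)"
    "s \<notin> {a<..<b} \<Longrightarrow> \<phi> s = 0" "s \<notin> {a<..<b} \<Longrightarrow> deriv \<phi> s = 0"
proof -
  obtain D where D: "\<And>s. (\<phi> has_real_derivative D s) (at s)" "continuous_on UNIV D"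
    using assms by (auto simp: test_function_def C1_differentiable_on_def
        has_real_derivative_iff_has_vector_derivative)
  then have "deriv \<phi> = D" using DERIV_imp_deriv by blast
  then show "(\<phi> has_real_derivative deriv \<phi> s) (at s)" "continuous_on UNIV (deriv \<phi>)" using D by auto
  have sub: "closure {s. \<phi> s \<noteq> 0} \<subseteq> {a<..<b}" using assms by (simp add: test_function_def)
  show "\<phi> s = 0" if "s \<notin> {a<..<b}" using sub closure_subset[of "{s. \<phi> s \<noteq> 0}"] that by blast
  show "deriv \<phi> s = 0" if s: "s \<notin> {a<..<b}"
  proof -
    have "\<forall>\<^sub>F r in nhds s. r \<in> - closure {s. \<phi> s \<noteq> 0}"
      using sub s by (intro eventually_nhds_in_open) auto
    then have "\<forall>\<^sub>F r in nhds s. \<phi> r = 0"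
      using closure_subset[of "{s. \<phi> s \<noteq> 0}"] by (auto elim!: eventually_mono)
    then have "(\<phi> has_real_derivative 0) (at s)"
      by (subst DERIV_cong_ev[OF refl _ refl, of _ "\<lambda>_. 0"]) auto
    then show ?thesis by (rule DERIV_imp_deriv)
  qed
qed

lemma has_weak_deriv_subinterval:
  assumes v: "has_weak_deriv y v a b" and sub: "{c..e} \<subseteq> {a..b}"
  shows "has_weak_deriv y v c e"
proof (cases "c \<le> e")
  case False
  then show ?thesis by (simp add: has_weak_deriv_def)
next
  case True
  show ?thesis unfolding has_weak_deriv_def
  proof (intro conjI allI impI)
    show "v absolutely_integrable_on {c..e}"
      using v sub absolutely_integrable_on_subinterval unfolding has_weak_deriv_def by blast
    fix \<phi> assume t: "test_function c e \<phi>"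
    then have t': "test_function a b \<phi>" using sub True by (fastforce simp: test_function_def)
    have *: "integral {c..e} f = integral {a..b} f" if "\<And>s. s \<notin> {c<..<e} \<Longrightarrow> f s = 0" for f :: "real \<Rightarrow> 'a"
    proof -
      have "integral {a..b} f = integral {a..b} (\<lambda>s. if s \<in> {c..e} then f s else 0)"
        by (rule integral_cong) (use that in auto)
      also have "\<dots> = integral ({c..e} \<inter> {a..b}) f" by (rule integral_restrict_Int)
      also have "{c..e} \<inter> {a..b} = {c..e}" using sub by auto
      finally show ?thesis ..
    qed
    have "integral {c..e} (\<lambda>s. deriv \<phi> s *\<^sub>R y s) = integral {a..b} (\<lambda>s. deriv \<phi> s *\<^sub>R y s)"
      by (rule *) (simp add: test_function_C1_deriv[OF t])
    also have "\<dots> = - integral {a..b} (\<lambda>s. \<phi> s *\<^sub>R v s)" using v t' by (simp add: has_weak_deriv_def)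
    also have "integral {a..b} (\<lambda>s. \<phi> s *\<^sub>R v s) = integral {c..e} (\<lambda>s. \<phi> s *\<^sub>R v s)"
      by (rule *[symmetric]) (simp add: test_function_C1_deriv[OF t])
    finally show "integral {c..e} (\<lambda>s. deriv \<phi> s *\<^sub>R y s) = - integral {c..e} (\<lambda>s. \<phi> s *\<^sub>R v s)" .
  qed
qed

text \<open>Henstock's lemma controls the sum of \<open>\<bar>content k * f x - \<integral>\<^sub>k f\<bar>\<close> over fine divisions.  When all the
  integrals over subintervals vanish, this sum is a Riemann sum of \<open>\<bar>f\<bar>\<close>, so \<open>\<bar>f\<bar>\<close> has integral \<open>0\<close>.\<close>

lemma AE_zero_if_zero_integrals:
  fixes f :: "real \<Rightarrow> 'a::euclidean_space"
  assumes f: "f absolutely_integrable_on {a..b}"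
    and zero: "\<And>c e. c \<le> e \<Longrightarrow> {c..e} \<subseteq> {a..b} \<Longrightarrow> integral {c..e} f = 0"
  shows "AE s in lebesgue_on {a..b}. f s = 0"
proof -
  have fi: "f integrable_on cbox a b" using f by (simp add: absolutely_integrable_on_def)
  have "((\<lambda>s. norm (f s)) has_integral 0) (cbox a b)"
    unfolding has_integral
  proof (intro allI impI)
    fix r :: real assume "r > 0"
    obtain \<gamma> where g: "gauge \<gamma>"
      and \<gamma>: "\<And>p. \<lbrakk>p tagged_partial_division_of (cbox a b); \<gamma> fine p\<rbrakk> \<Longrightarrow>
             sum (\<lambda>(x,k). norm(measure lborel k *\<^sub>R f x - integral k f)) p < r"
      using Henstock_lemma[OF fi \<open>r > 0\<close>] by blast
    have small: "norm ((\<Sum>(x, k)\<in>p. measure lborel k *\<^sub>R norm (f x)) - 0) < r"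
      if p: "p tagged_division_of cbox a b" "\<gamma> fine p" for p
    proof -
      have "(\<Sum>(x, k)\<in>p. measure lborel k *\<^sub>R norm (f x)) = (\<Sum>(x,k)\<in>p. norm(measure lborel k *\<^sub>R f x - integral k f))"
      proof (rule sum.cong[OF refl], clarify)
        fix x k assume xk: "(x, k) \<in> p"
        obtain c e where k: "k = cbox c e" using tagged_division_ofD(4)[OF p(1) xk] by blast
        have "x \<in> k" "k \<subseteq> cbox a b" using tagged_division_ofD(2,3)[OF p(1) xk] by auto
        then have "integral k f = 0" using zero[of c e] by (auto simp: k)
        then show "measure lborel k *\<^sub>R norm (f x) = norm (measure lborel k *\<^sub>R f x - integral k f)" by simp
      qed
      also have "\<dots> < r" using p by (intro \<gamma>) (auto simp: tagged_division_of_def)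
      finally have "(\<Sum>(x, k)\<in>p. measure lborel k *\<^sub>R norm (f x)) < r" .
      moreover have "0 \<le> (\<Sum>(x, k)\<in>p. measure lborel k *\<^sub>R norm (f x))" by (intro sum_nonneg) auto
      ultimately show ?thesis by simp
    qed
    show "\<exists>\<gamma>. gauge \<gamma> \<and> (\<forall>\<D>. \<D> tagged_division_of cbox a b \<and> \<gamma> fine \<D> \<longrightarrow>
        norm ((\<Sum>(x, k)\<in>\<D>. measure lborel k *\<^sub>R norm (f x)) - 0) < r)"
      by (rule exI[of _ \<gamma>]) (intro conjI g allI impI, elim conjE, rule small)
  qed
  then have i0: "integral {a..b} (\<lambda>s. norm (f s)) = 0" by (simp add: integral_unique)
  have fn: "integrable (lebesgue_on {a..b}) (\<lambda>s. norm (f s))"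
    using f by (simp add: integrable_norm integrable_restrict_space set_integrable_def)
  have "integral\<^sup>L (lebesgue_on {a..b}) (\<lambda>s. norm (f s)) = 0"
    using lebesgue_integral_eq_integral[OF fn] i0 by simp
  then have "AE s in lebesgue_on {a..b}. norm (f s) = 0"
    using fn by (subst (asm) integral_nonneg_eq_0_iff_AE) auto
  then show ?thesis by simp
qed

text \<open>Both candidates integrate to the increment of \<open>y\<close> over every subinterval.\<close>

lemma has_weak_deriv_unique_AE:
  fixes y :: "real \<Rightarrow> 'a::euclidean_space"
  assumes v: "has_weak_deriv y v a b" and w: "has_weak_deriv y w a b" and y: "continuous_on {a..b} y"
  shows "AE s in lebesgue_on {a..b}. v s = w s"
proof -
  have "AE s in lebesgue_on {a..b}. v s - w s = 0"
  proof (rule AE_zero_if_zero_integrals)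
    show "(\<lambda>s. v s - w s) absolutely_integrable_on {a..b}"
      using v w by (intro set_integral_diff) (auto simp: has_weak_deriv_def)
    fix c e :: real assume ce: "c \<le> e" "{c..e} \<subseteq> {a..b}"
    have vw: "has_weak_deriv y v c e" "has_weak_deriv y w c e"
      using has_weak_deriv_subinterval v w ce(2) by blast+
    show "integral {c..e} (\<lambda>s. v s - w s) = 0"
    proof (cases "c = e")
      case False
      then have "integral {c..e} v = integral {c..e} w"
        using has_weak_deriv_increment[OF vw(1)] has_weak_deriv_increment[OF vw(2)]
          continuous_on_subset[OF y ce(2)] ce(1) by simp
      moreover have "v integrable_on {c..e}" "w integrable_on {c..e}"
        using vw by (auto simp: has_weak_deriv_def absolutely_integrable_on_def)
      ultimately show ?thesis by (simp add: integral_diff)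
    qed simp
  qed
  then show ?thesis by simp
qed

lemma weak_deriv_AE_eq:
  assumes "has_weak_deriv y v a b" "continuous_on {a..b} y"
  shows "AE s in lebesgue_on {a..b}. weak_deriv a b y s = v s"
proof -
  have "has_weak_deriv y (weak_deriv a b y) a b"
    using someI[of "\<lambda>v. has_weak_deriv y v a b" v, OF assms(1)] by (simp only: weak_deriv_def)
  from has_weak_deriv_unique_AE[OF this assms] show ?thesis .
qed

lemma has_weak_deriv_primitive:
  fixes w :: "real \<Rightarrow> 'a::euclidean_space"
  assumes w: "continuous_on {a..b} w" and ab: "a \<le> b"
  shows "has_weak_deriv (\<lambda>s. x + integral {a..s} w) w a b"
proof -
  define y where "y s = x + integral {a..s} w" for s
  have dy: "(y has_vector_derivative w s) (at s within {a..b})" if "s \<in> {a..b}" for s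
    unfolding y_def using integral_has_vector_derivative[OF w that]
    by (auto intro!: derivative_eq_intros)
  have cy: "continuous_on {a..b} y" using dy continuous_on_vector_derivative by blast
  have "integral {a..b} (\<lambda>s. deriv \<phi> s *\<^sub>R y s) = - integral {a..b} (\<lambda>s. \<phi> s *\<^sub>R w s)"
    if t: "test_function a b \<phi>" for \<phi>
  proof -
    note T = test_function_C1_deriv[OF t]
    have "((\<lambda>s. \<phi> s *\<^sub>R w s + deriv \<phi> s *\<^sub>R y s) has_integral \<phi> b *\<^sub>R y b - \<phi> a *\<^sub>R y a) {a..b}"
    proof (rule fundamental_theorem_of_calculus[OF ab])
      fix s assume s: "s \<in> {a..b}"
      have "(\<phi> has_vector_derivative deriv \<phi> s) (at s within {a..b})"
        using T(1)[of s] by (simp add: has_real_derivative_iff_has_vector_derivative has_vector_derivative_at_within)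
      then have "((\<lambda>s. \<phi> s *\<^sub>R y s) has_vector_derivative \<phi> s *\<^sub>R w s + deriv \<phi> s *\<^sub>R y s) (at s within {a..b})"
        using dy[OF s] by (intro has_vector_derivative_scaleR) (simp_all add: has_real_derivative_iff_has_vector_derivative)
      then show "((\<lambda>s. \<phi> s *\<^sub>R y s) has_vector_derivative \<phi> s *\<^sub>R w s + deriv \<phi> s *\<^sub>R y s) (at s within {a..b})" .
    qed
    moreover have "\<phi> a = 0" "\<phi> b = 0" by (auto simp: T)
    moreover have "continuous_on {a..b} \<phi>"
      using T(1) by (meson DERIV_isCont continuous_at_imp_continuous_on)
    ultimately have "integral {a..b} (\<lambda>s. \<phi> s *\<^sub>R w s) + integral {a..b} (\<lambda>s. deriv \<phi> s *\<^sub>R y s) = 0"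
      using continuous_on_subset[OF T(2), of "{a..b}"]
      by (subst integral_add[symmetric])
         (auto intro!: integrable_continuous_real continuous_intros w cy integral_unique)
    then show ?thesis by (simp add: add_eq_0_iff)
  qed
  then show ?thesis
    using absolutely_integrable_continuous_real[OF w]
    unfolding y_def has_weak_deriv_def by blast
qed

lemma has_weak_deriv_convex_combination:
  fixes y1 y2 :: "real \<Rightarrow> 'a::euclidean_space"
  assumes v1: "has_weak_deriv y1 v1 a b" and v2: "has_weak_deriv y2 v2 a b"
    and y1: "continuous_on {a..b} y1" and y2: "continuous_on {a..b} y2"
  shows "has_weak_deriv (\<lambda>s. \<alpha> *\<^sub>R y1 s + \<beta> *\<^sub>R y2 s) (\<lambda>s. \<alpha> *\<^sub>R v1 s + \<beta> *\<^sub>R v2 s) a b"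
  unfolding has_weak_deriv_def
proof (intro conjI allI impI)
  have i1: "v1 absolutely_integrable_on {a..b}" and i2: "v2 absolutely_integrable_on {a..b}"
    using v1 v2 by (auto simp: has_weak_deriv_def)
  show "(\<lambda>s. \<alpha> *\<^sub>R v1 s + \<beta> *\<^sub>R v2 s) absolutely_integrable_on {a..b}"
    by (intro set_integral_add absolutely_integrable_continuous_scaleR[of a b "\<lambda>_. \<alpha>"]
        absolutely_integrable_continuous_scaleR[of a b "\<lambda>_. \<beta>"] i1 i2 continuous_on_const)
  fix \<phi> assume t: "test_function a b \<phi>"
  note T = test_function_C1_deriv[OF t]
  have \<phi>: "continuous_on {a..b} \<phi>"
    using T(1) by (meson DERIV_isCont continuous_at_imp_continuous_on)
  have d\<phi>: "continuous_on {a..b} (deriv \<phi>)" using T(2) continuous_on_subset by blast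
  have comb: "integral {a..b} (\<lambda>s. \<psi> s *\<^sub>R (\<alpha> *\<^sub>R w1 s + \<beta> *\<^sub>R w2 s))
      = \<alpha> *\<^sub>R integral {a..b} (\<lambda>s. \<psi> s *\<^sub>R w1 s) + \<beta> *\<^sub>R integral {a..b} (\<lambda>s. \<psi> s *\<^sub>R w2 s)"
    if \<psi>: "continuous_on {a..b} \<psi>" and w: "w1 absolutely_integrable_on {a..b}" "w2 absolutely_integrable_on {a..b}"
    for \<psi> and w1 w2 :: "real \<Rightarrow> 'a"
  proof -
    have "(\<lambda>s. \<psi> s *\<^sub>R w1 s) integrable_on {a..b}" "(\<lambda>s. \<psi> s *\<^sub>R w2 s) integrable_on {a..b}"
      using absolutely_integrable_continuous_scaleR[OF \<psi>] w by (auto simp: absolutely_integrable_on_def)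
    then have "((\<lambda>s. \<alpha> *\<^sub>R \<psi> s *\<^sub>R w1 s + \<beta> *\<^sub>R \<psi> s *\<^sub>R w2 s) has_integral
      \<alpha> *\<^sub>R integral {a..b} (\<lambda>s. \<psi> s *\<^sub>R w1 s) + \<beta> *\<^sub>R integral {a..b} (\<lambda>s. \<psi> s *\<^sub>R w2 s)) {a..b}"
      by (intro has_integral_add has_integral_cmul integrable_integral)
    moreover have "(\<lambda>s. \<alpha> *\<^sub>R \<psi> s *\<^sub>R w1 s + \<beta> *\<^sub>R \<psi> s *\<^sub>R w2 s)
        = (\<lambda>s. \<psi> s *\<^sub>R (\<alpha> *\<^sub>R w1 s + \<beta> *\<^sub>R w2 s))"
      by (simp add: scaleR_add_right mult.commute)
    ultimately show ?thesis by (simp add: integral_unique)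
  qed
  show "integral {a..b} (\<lambda>s. deriv \<phi> s *\<^sub>R (\<alpha> *\<^sub>R y1 s + \<beta> *\<^sub>R y2 s))
      = - integral {a..b} (\<lambda>s. \<phi> s *\<^sub>R (\<alpha> *\<^sub>R v1 s + \<beta> *\<^sub>R v2 s))"
    using v1 v2 t
    by (simp add: comb[OF d\<phi>] comb[OF \<phi>] i1 i2 y1 y2 absolutely_integrable_continuous_real has_weak_deriv_def)
qed

section \<open>Continuous functions on Euclidean space: minima and zeros\<close>

lemma attains_min_of_at_top:
  fixes F :: "'a::euclidean_space \<Rightarrow> real"
  assumes F: "continuous_on UNIV F" and lim: "filterlim F at_top at_infinity"
  shows "\<exists>p. \<forall>q. F p \<le> F q"
proof -
  have "\<forall>\<^sub>F q in at_infinity. F 0 \<le> F q" using lim by (simp add: filterlim_at_top)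
  then obtain r where r: "\<And>q. r \<le> norm q \<Longrightarrow> F 0 \<le> F q" by (auto simp: eventually_at_infinity)
  have "compact (cball (0::'a) \<bar>r\<bar>)" "cball (0::'a) \<bar>r\<bar> \<noteq> {}" by auto
  then obtain p where p: "\<And>q. q \<in> cball 0 \<bar>r\<bar> \<Longrightarrow> F p \<le> F q"
    using continuous_attains_inf[of "cball 0 \<bar>r\<bar>" F] continuous_on_subset[OF F] by blast
  have "F p \<le> F q" for q
  proof (cases "norm q \<le> \<bar>r\<bar>")
    case False
    then have "F 0 \<le> F q" by (intro r) auto
    then show ?thesis using p[of 0] by simp
  qed (auto intro: p)
  then show ?thesis by blast
qed

text \<open>Without a zero, the map \<open>p \<mapsto> - r F(p) / \<bar>F(p)\<bar>\<close> would have a Brouwer fixed point on the sphere, at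
  which \<open>F\<close> points inward.\<close>

lemma zero_if_outward_on_sphere:
  fixes F :: "'a::euclidean_space \<Rightarrow> 'a"
  assumes F: "continuous_on (cball 0 r) F" and r: "0 < r"
    and out: "\<And>p. norm p = r \<Longrightarrow> 0 \<le> F p \<bullet> p"
  shows "\<exists>p. F p = 0"
proof (rule ccontr)
  assume "\<nexists>p. F p = 0"
  then have nz: "F p \<noteq> 0" for p by blast
  define N where "N p = - (r / norm (F p)) *\<^sub>R F p" for p
  have "continuous_on (cball 0 r) N"
    unfolding N_def[abs_def] using nz by (intro continuous_intros F) auto
  moreover have nN: "norm (N p) = r" for p using nz[of p] r by (simp add: N_def)
  ultimately obtain p where p: "N p = p"
    using brouwer_ball[OF r, of 0 N] by (auto simp: Pi_iff)
  have "0 \<le> F p \<bullet> N p" using out[of p] nN[of p] p by simp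
  moreover have "F p \<bullet> N p = - (r / norm (F p)) * (norm (F p))\<^sup>2"
    by (simp add: N_def power2_norm_eq_inner)
  moreover have "\<dots> < 0" using nz[of p] r by (simp add: power2_eq_square)
  ultimately show False by simp
qed

section \<open>Smooth, strictly convex, superlinear functions\<close>

lemma strictly_convex_imp_convex_on:
  assumes "strictly_convex f"
  shows "convex_on UNIV f"
proof (rule convex_onI)
  fix u :: real and x y :: 'a
  assume u: "0 < u" "u < 1"
  show "f ((1 - u) *\<^sub>R x + u *\<^sub>R y) \<le> (1 - u) * f x + u * f y"
  proof (cases "x = y")
    case True
    then show ?thesis by (simp add: algebra_simps flip: scaleR_left.add)
  next
    case False
    then show ?thesis using assms u by (simp add: strictly_convex_def less_imp_le)
  qed
qed simp

text \<open>Reduced to the one-dimensional tangent inequality on the line through \<open>w\<close> and \<open>v\<close>.\<close>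

lemma convex_above_gradient:
  fixes f :: "'a::real_inner \<Rightarrow> real"
  assumes f: "convex_on UNIV f" and D: "GDERIV f w :> D"
  shows "f w + D \<bullet> (v - w) \<le> f v"
proof -
  define \<phi> where "\<phi> u = f (w + u *\<^sub>R (v - w))" for u :: real
  have "convex_on UNIV \<phi>"
  proof (rule convex_onI)
    fix u a b :: real assume u: "0 < u" "u < 1"
    have "w + ((1 - u) *\<^sub>R a + u *\<^sub>R b) *\<^sub>R (v - w)
        = (1 - u) *\<^sub>R (w + a *\<^sub>R (v - w)) + u *\<^sub>R (w + b *\<^sub>R (v - w))"
      by (simp add: algebra_simps)
    then show "\<phi> ((1 - u) *\<^sub>R a + u *\<^sub>R b) \<le> (1 - u) * \<phi> a + u * \<phi> b"
      unfolding \<phi>_def using convex_onD[OF f, of u] u by simp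
  qed simp
  moreover have "(\<phi> has_field_derivative D \<bullet> (v - w)) (at 0 within UNIV)"
  proof -
    have "((\<lambda>u. f (w + u *\<^sub>R (v - w))) has_derivative (\<lambda>u. (u *\<^sub>R (v - w)) \<bullet> D)) (at 0)"
    proof (rule has_derivative_compose[where f="\<lambda>u. w + u *\<^sub>R (v - w)" and g=f])
      show "((\<lambda>u. w + u *\<^sub>R (v - w)) has_derivative (\<lambda>u. u *\<^sub>R (v - w))) (at 0)"
        by (auto intro!: derivative_eq_intros)
      show "(f has_derivative (\<lambda>h. h \<bullet> D)) (at (w + 0 *\<^sub>R (v - w)))" using D by (simp add: gderiv_def)
    qed
    then show ?thesis
      by (simp add: \<phi>_def[abs_def] has_field_derivative_def inner_commute mult_commute_abs)
  qed
  ultimately have "\<phi> 1 - \<phi> 0 \<ge> D \<bullet> (v - w) * (1 - 0)"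
    by (intro convex_on_imp_above_tangent) auto
  then show ?thesis by (simp add: \<phi>_def)
qed

lemma gradient_eqI:
  assumes "GDERIV f x :> D"
  shows "gradient f x = D"
  unfolding gradient_def
proof (rule the_equality[where a=D])
  show "GDERIV f x :> D" by fact
  fix E assume "GDERIV f x :> E"
  then have "(\<lambda>h. h \<bullet> E) = (\<lambda>h. h \<bullet> D)"
    using assms has_derivative_unique unfolding gderiv_def by blast
  then show "E = D" by (metis inner_commute vector_eq_rdot)
qed

text \<open>Under these conditions the gradient is a homeomorphism of the whole space; \<open>grad_inv q\<close> is the
  point at which the supporting hyperplane of slope \<open>q\<close> touches the graph of \<open>f\<close>.\<close>

locale legendre_function =
  fixes f :: "'a::euclidean_space \<Rightarrow> real"
  assumes GDERIV_gradient: "\<And>w. GDERIV f w :> gradient f w"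
    and continuous_gradient: "continuous_on UNIV (gradient f)"
    and strict: "strictly_convex f"
    and coercive: "coercive f"
begin

abbreviation grad_inv :: "'a \<Rightarrow> 'a" where "grad_inv \<equiv> inv (gradient f)"

lemma continuous_f: "continuous_on S f"
  using GDERIV_gradient
  by (meson continuous_at_imp_continuous_on gderiv_def has_derivative_continuous)

lemma above_tangent: "f w + gradient f w \<bullet> (v - w) \<le> f v"
  using convex_above_gradient[OF strictly_convex_imp_convex_on[OF strict] GDERIV_gradient] .

text \<open>Two points with the same gradient have parallel supporting hyperplanes; averaging their tangent
  inequalities at the midpoint contradicts strict convexity.\<close>

lemma inj_gradient: "inj (gradient f)"
proof (rule injI, rule ccontr)
  fix v w assume eq: "gradient f v = gradient f w" and "v \<noteq> w"
  define m where "m = (1 - 1/2) *\<^sub>R v + (1/2) *\<^sub>R w"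
  have "f m < (1 - 1/2) * f v + 1/2 * f w"
    using strict \<open>v \<noteq> w\<close> unfolding strictly_convex_def m_def
    by (metis half_gt_zero_iff less_numeral_extra(1) field_sum_of_halves less_add_same_cancel2)
  moreover have "f v + gradient f v \<bullet> (m - v) \<le> f m" "f w + gradient f v \<bullet> (m - w) \<le> f m"
    using above_tangent[of v m] above_tangent[of w m] eq by auto
  moreover have "gradient f v \<bullet> (m - v) + gradient f v \<bullet> (m - w) = 0"
    by (simp add: m_def inner_diff_right inner_add_right)
  ultimately show False by simp
qed

lemma superlinear: "\<exists>c. \<forall>w. R * norm w - c \<le> f w"
proof -
  have "\<forall>\<^sub>F w in at_infinity. R \<le> f w / norm w"
    using coercive by (simp add: coercive_def filterlim_at_top)
  then obtain b where b: "\<And>w. b \<le> norm w \<Longrightarrow> R \<le> f w / norm w"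
    by (auto simp: eventually_at_infinity)
  define r where "r = \<bar>b\<bar> + 1"
  have "compact (cball (0::'a) r)" "cball (0::'a) r \<noteq> {}" by (auto simp: r_def)
  moreover have "continuous_on (cball 0 r) (\<lambda>w. f w - R * norm w)"
    by (intro continuous_intros continuous_f)
  ultimately obtain p where p: "\<And>q. q \<in> cball 0 r \<Longrightarrow> f p - R * norm p \<le> f q - R * norm q"
    using continuous_attains_inf[of "cball 0 r" "\<lambda>w. f w - R * norm w"] by blast
  have "R * norm w - \<bar>f p - R * norm p\<bar> \<le> f w" for w
  proof (cases "norm w \<le> r")
    case True
    then show ?thesis using p[of w] by simp
  next
    case False
    then have "b \<le> norm w" "0 < norm w" by (auto simp: r_def)
    then have "R * norm w \<le> f w" using b[of w] by (simp add: field_simps)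
    then show ?thesis by simp
  qed
  then show ?thesis by blast
qed

text \<open>Superlinearity makes \<open>f(w) - q \<bullet> w\<close> attain its minimum, and there the gradient of \<open>f\<close> is \<open>q\<close>.\<close>

lemma surj_gradient: "surj (gradient f)"
proof -
  have "\<exists>w. gradient f w = q" for q
  proof -
    define F where "F w = f w - q \<bullet> w" for w
    obtain c where c: "\<And>w. (norm q + 1) * norm w - c \<le> f w"
      using superlinear[of "norm q + 1"] by blast
    have Fge: "norm w - c \<le> F w" for w
      using c[of w] norm_cauchy_schwarz[of q w] by (simp add: F_def algebra_simps)
    have lim: "filterlim F at_top at_infinity"
      unfolding filterlim_at_top eventually_at_infinity
    proof
      fix Z
      show "\<exists>b. \<forall>w. b \<le> norm w \<longrightarrow> Z \<le> F w"
      proof (intro exI allI impI)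
        fix w :: 'a assume "Z + c \<le> norm w"
        then show "Z \<le> F w" using Fge[of w] by linarith
      qed
    qed
    have cF: "continuous_on UNIV F" unfolding F_def[abs_def] by (intro continuous_intros continuous_f)
    obtain w where w: "\<And>v. F w \<le> F v" using attains_min_of_at_top[OF cF lim] by blast
    have "(F has_derivative (\<lambda>h. h \<bullet> gradient f w - q \<bullet> h)) (at w)"
      unfolding F_def[abs_def] using GDERIV_gradient[of w, unfolded gderiv_def]
      by (auto intro!: derivative_eq_intros)
    then have "(\<lambda>h. h \<bullet> gradient f w - q \<bullet> h) = (\<lambda>h. 0)"
      by (rule differential_zero_maxmin[OF _ open_UNIV, rotated]) (use w in auto)
    then have "(gradient f w - q) \<bullet> h = 0" for h
      by (metis inner_commute inner_diff_right)
    then have "gradient f w = q" by (metis inner_eq_zero_iff right_minus_eq)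
    then show ?thesis by blast
  qed
  then show ?thesis by (metis surjI)
qed

lemma gradient_grad_inv [simp]: "gradient f (grad_inv q) = q"
  using surj_gradient by (rule surj_f_inv_f)

text \<open>A continuous injection of Euclidean space into itself is open, by invariance of domain.\<close>

lemma continuous_grad_inv: "continuous_on S grad_inv"
proof -
  have "continuous_on (range (gradient f)) grad_inv"
    by (rule continuous_on_inverse_open[OF open_UNIV continuous_gradient])
       (simp_all add: inv_f_f[OF inj_gradient])
  then show ?thesis using surj_gradient continuous_on_subset by (metis subset_UNIV)
qed

lemma grad_inv_above_tangent: "f (grad_inv q) + q \<bullet> (v - grad_inv q) \<le> f v"
  using above_tangent[of "grad_inv q" v] by simp

text \<open>The inverse gradient is superlinearly coercive because \<open>f\<close> is finite everywhere: compare the tangent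
  inequality at the point \<open>R q / \<bar>q\<bar>\<close> with a lower bound of \<open>f\<close>.\<close>

lemma grad_inv_coercive:
  assumes "0 \<le> R"
  shows "\<exists>c. \<forall>q. R * norm q - c \<le> q \<bullet> grad_inv q"
proof -
  obtain c0 where c0: "\<And>w. 0 * norm w - c0 \<le> f w"
    using superlinear[of 0] by blast
  have "compact (cball (0::'a) R)" "cball (0::'a) R \<noteq> {}" using assms by auto
  then obtain M where M: "\<And>w. w \<in> cball 0 R \<Longrightarrow> f w \<le> f M"
    using continuous_attains_sup[of "cball 0 R" f] continuous_f by blast
  have "R * norm q - (f M + c0) \<le> q \<bullet> grad_inv q" for q
  proof -
    define v where "v = R *\<^sub>R sgn q"
    have "norm v \<le> R" using assms by (simp add: v_def norm_sgn)
    then have "f v \<le> f M" by (intro M) simp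
    moreover have "q \<bullet> v = R * norm q"
      by (cases "q = 0") (simp_all add: v_def sgn_div_norm dot_square_norm power2_eq_square)
    ultimately show ?thesis
      using grad_inv_above_tangent[of q v] c0[of "grad_inv q"] by (simp add: inner_diff_right)
  qed
  then show ?thesis by blast
qed

end

lemma legendre_function_scale:
  assumes C2: "C2_function f" and sc: "strictly_convex f" and co: "coercive f" and l: "0 < (l::real)"
  shows "legendre_function (\<lambda>w. l * f w)"
proof -
  obtain G and H :: "'a \<Rightarrow> 'a \<Rightarrow>\<^sub>L 'a" where G: "\<And>x. GDERIV f x :> G x"
    and H: "\<And>x. (G has_derivative blinfun_apply (H x)) (at x)"
    using C2 unfolding C2_function_def by blast
  have cG: "continuous_on UNIV G"
    by (intro continuous_at_imp_continuous_on ballI has_derivative_continuous[OF H])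
  have D: "GDERIV (\<lambda>w. l * f w) x :> l *\<^sub>R G x" for x
    using G[of x] unfolding gderiv_def by (auto intro!: derivative_eq_intros)
  then have grad: "gradient (\<lambda>w. l * f w) = (\<lambda>x. l *\<^sub>R G x)" by (intro ext gradient_eqI)
  show ?thesis
  proof
    show "GDERIV (\<lambda>w. l * f w) w :> gradient (\<lambda>w. l * f w) w" for w unfolding grad by (rule D)
    show "continuous_on UNIV (gradient (\<lambda>w. l * f w))" unfolding grad by (intro continuous_intros cG)
    show "strictly_convex (\<lambda>w. l * f w)"
      unfolding strictly_convex_def
    proof (intro allI impI)
      fix x y :: 'a and u :: real assume "x \<noteq> y" "0 < u" "u < 1"
      then have "f ((1 - u) *\<^sub>R x + u *\<^sub>R y) < (1 - u) * f x + u * f y"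
        using sc by (simp add: strictly_convex_def)
      then have "l * f ((1 - u) *\<^sub>R x + u *\<^sub>R y) < l * ((1 - u) * f x + u * f y)"
        using l by (intro mult_strict_left_mono)
      then show "l * f ((1 - u) *\<^sub>R x + u *\<^sub>R y) < (1 - u) * (l * f x) + u * (l * f y)"
        by (simp add: algebra_simps)
    qed
    have "filterlim (\<lambda>w. f w / norm w) at_top at_infinity" using co by (simp add: coercive_def)
    then show "coercive (\<lambda>w. l * f w)"
      using filterlim_tendsto_pos_mult_at_top[OF tendsto_const l, of "\<lambda>w. f w / norm w" at_infinity]
      by (simp add: coercive_def)
  qed
qed

section \<open>The scalar variational problem\<close>

lemma integral_le_AE:
  fixes f g :: "real \<Rightarrow> real"
  assumes "f absolutely_integrable_on {a..b}" "g absolutely_integrable_on {a..b}"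
    and "AE s in lebesgue_on {a..b}. f s \<le> g s"
  shows "integral {a..b} f \<le> integral {a..b} g"
proof -
  have i: "integrable (lebesgue_on {a..b}) f" "integrable (lebesgue_on {a..b}) g"
    using assms by (auto simp: integrable_restrict_space set_integrable_def)
  show ?thesis
    using integral_mono_AE[OF i assms(3)] i by (simp add: lebesgue_integral_eq_integral)
qed

text \<open>Minimize \<open>\<integral> \<delta> f(v) + G(\<integral> v)\<close> over integrable velocities \<open>v\<close> on \<open>[t, T]\<close>.  The candidates are the
  velocities that solve the Euler-Lagrange equation \<open>\<delta> \<nabla>f(v) = p\<close> for a constant costate \<open>p\<close>.\<close>

locale discounted_problem = legendre_function f
  for f :: "'a::euclidean_space \<Rightarrow> real" +
  fixes \<delta> :: "real \<Rightarrow> real" and a t T :: real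
  assumes tT: "t < T" and a_pos: "0 < a"
    and \<delta>_bounds: "\<And>s. s \<in> {t..T} \<Longrightarrow> a < \<delta> s \<and> \<delta> s \<le> 1"
    and \<delta>_cont: "continuous_on {t..T} \<delta>"
begin

definition velocity :: "'a \<Rightarrow> real \<Rightarrow> 'a" where
  "velocity p s = grad_inv (p /\<^sub>R \<delta> s)"

definition displacement :: "'a \<Rightarrow> 'a" where
  "displacement p = integral {t..T} (velocity p)"

definition running_cost :: "'a \<Rightarrow> real" where
  "running_cost p = integral {t..T} (\<lambda>s. \<delta> s * f (velocity p s))"

lemma \<delta>_pos: "s \<in> {t..T} \<Longrightarrow> 0 < \<delta> s"
  using \<delta>_bounds a_pos by force

lemma \<delta>_mult_le:
  assumes "s \<in> {t..T}"
  shows "\<delta> s * c \<le> \<bar>c\<bar>"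
proof -
  have \<delta>: "0 < \<delta> s" "\<delta> s \<le> 1" using \<delta>_pos \<delta>_bounds assms by auto
  then have "\<delta> s * c \<le> \<delta> s * \<bar>c\<bar>" by simp
  also have "\<dots> \<le> 1 * \<bar>c\<bar>" using \<delta> by (intro mult_right_mono) auto
  finally show ?thesis by simp
qed

lemma continuous_velocity_joint: "continuous_on (UNIV \<times> {t..T}) (\<lambda>(p, s). velocity p s)"
proof -
  have "continuous_on (UNIV \<times> {t..T}) (\<lambda>z::'a \<times> real. \<delta> (snd z))"
    by (rule continuous_on_compose2[OF \<delta>_cont]) (auto intro!: continuous_intros)
  then have "continuous_on (UNIV \<times> {t..T}) (\<lambda>z::'a \<times> real. fst z /\<^sub>R \<delta> (snd z))"
    using \<delta>_pos by (intro continuous_intros) (auto simp: mem_Times_iff, force)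
  then show ?thesis
    unfolding velocity_def split_beta
    by (rule continuous_on_compose2[OF continuous_grad_inv[of UNIV]]) simp
qed

lemma continuous_velocity: "continuous_on {t..T} (velocity p)"
proof -
  have "continuous_on {t..T} (\<lambda>s. (p, s))" by (intro continuous_intros)
  moreover have "(\<lambda>s. (p, s)) ` {t..T} \<subseteq> UNIV \<times> {t..T}" by auto
  ultimately show ?thesis using continuous_on_compose2[OF continuous_velocity_joint] by fastforce
qed

lemma continuous_displacement: "continuous_on S displacement"
proof -
  have "continuous_on UNIV (\<lambda>p. integral (cbox t T) (velocity p))"
    using continuous_velocity_joint by (intro integral_continuous_on_param) simp
  then show ?thesis unfolding displacement_def[abs_def] using continuous_on_subset by auto
qed

lemma continuous_cost_density: "continuous_on {t..T} (\<lambda>s. \<delta> s * f (velocity p s))"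
  by (intro continuous_intros \<delta>_cont continuous_on_compose2[OF continuous_f[of UNIV]]
      continuous_velocity) simp

lemma continuous_running_cost: "continuous_on UNIV running_cost"
proof -
  have "continuous_on (UNIV \<times> {t..T}) (\<lambda>z::'a \<times> real. \<delta> (snd z))"
    by (rule continuous_on_compose2[OF \<delta>_cont]) (auto intro!: continuous_intros)
  moreover have "continuous_on (UNIV \<times> {t..T}) (\<lambda>z. f (velocity (fst z) (snd z)))"
    using continuous_velocity_joint unfolding split_beta
    by (rule continuous_on_compose2[OF continuous_f[of UNIV]]) simp
  ultimately have "continuous_on (UNIV \<times> cbox t T) (\<lambda>(p, s). \<delta> s * f (velocity p s))"
    unfolding split_beta by (intro continuous_intros) simp_all
  then have "continuous_on UNIV (\<lambda>p. integral (cbox t T) (\<lambda>s. \<delta> s * f (velocity p s)))"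
    by (rule integral_continuous_on_param)
  then show ?thesis unfolding running_cost_def[abs_def] by simp
qed

lemma displacement_inner: "((\<lambda>s. p \<bullet> velocity p s) has_integral p \<bullet> displacement p) {t..T}"
  using has_integral_linear[OF integrable_integral[OF integrable_continuous_real[OF continuous_velocity]]
      bounded_linear_inner_right[of p], of p]
  by (simp add: displacement_def o_def)

text \<open>With \<open>q = p / \<delta>\<close> the integrand \<open>p \<bullet> velocity p\<close> is \<open>\<delta> (q \<bullet> grad_inv q)\<close>; the bound \<open>R \<bar>q\<bar> - c\<close> for
  \<open>q \<bullet> grad_inv q\<close> becomes \<open>R \<bar>p\<bar> - \<delta> c\<close>, which is at least \<open>R \<bar>p\<bar> - \<bar>c\<bar>\<close> at every time as \<open>\<delta> \<le> 1\<close>.\<close>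

lemma displacement_coercive:
  assumes "0 \<le> R"
  shows "\<exists>c. \<forall>p. R * norm p - c \<le> p \<bullet> displacement p"
proof -
  define R' where "R' = R / (T - t)"
  have R': "0 \<le> R'" "(T - t) * R' = R" using assms tT by (auto simp: R'_def)
  obtain c where c: "\<And>q. R' * norm q - c \<le> q \<bullet> grad_inv q"
    using grad_inv_coercive[OF R'(1)] by blast
  have "R * norm p - (T - t) * \<bar>c\<bar> \<le> p \<bullet> displacement p" for p
  proof -
    have "((\<lambda>s. R' * norm p - \<bar>c\<bar>) has_integral (T - t) * (R' * norm p - \<bar>c\<bar>)) {t..T}"
      using has_integral_const_real[of "R' * norm p - \<bar>c\<bar>" t T] tT by simp
    then have "(T - t) * (R' * norm p - \<bar>c\<bar>) \<le> p \<bullet> displacement p"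
    proof (rule has_integral_le[OF _ displacement_inner])
      fix s assume s: "s \<in> {t..T}"
      define q where "q = p /\<^sub>R \<delta> s"
      have \<delta>: "0 < \<delta> s" "\<delta> s \<le> 1" using \<delta>_pos \<delta>_bounds s by auto
      have p: "p = \<delta> s *\<^sub>R q" using \<delta> by (simp add: q_def)
      have "\<delta> s * c \<le> \<bar>c\<bar>" by (rule \<delta>_mult_le[OF s])
      then have "R' * norm p - \<bar>c\<bar> \<le> \<delta> s * (R' * norm q - c)"
        using \<delta> by (subst p) (simp add: algebra_simps)
      also have "\<dots> \<le> \<delta> s * (q \<bullet> grad_inv q)" using c[of q] \<delta> by (intro mult_left_mono) auto
      also have "\<dots> = p \<bullet> velocity p s" by (simp add: velocity_def flip: q_def) (simp add: p)
      finally show "R' * norm p - \<bar>c\<bar> \<le> p \<bullet> velocity p s" .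
    qed
    also have "(T - t) * (R' * norm p - \<bar>c\<bar>) = R * norm p - (T - t) * \<bar>c\<bar>"
      unfolding R'(2)[symmetric] by (simp add: algebra_simps)
    finally show ?thesis .
  qed
  then show ?thesis by blast
qed

text \<open>Every displacement is realized by some costate, since \<open>displacement p - v\<close> points outward on a large
  sphere.\<close>

lemma surj_displacement: "\<exists>p. displacement p = v"
proof -
  obtain c where c: "\<And>p. (norm v + 1) * norm p - c \<le> p \<bullet> displacement p"
    using displacement_coercive[of "norm v + 1"] by auto
  have "0 \<le> (displacement p - v) \<bullet> p" if "norm p = \<bar>c\<bar> + 1" for p
  proof -
    have "v \<bullet> p \<le> norm v * norm p" by (rule norm_cauchy_schwarz)
    then show ?thesis using c[of p] that by (simp add: inner_diff_left inner_commute algebra_simps)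
  qed
  then have "\<exists>p. displacement p - v = 0"
    by (intro zero_if_outward_on_sphere[of "\<bar>c\<bar> + 1"] continuous_intros continuous_displacement) auto
  then show ?thesis by auto
qed

text \<open>Multiplying the tangent inequality at \<open>velocity p\<close> by \<open>\<delta>\<close> produces the linear term
  \<open>p \<bullet> (v - velocity p)\<close>; as \<open>p\<close> is constant in time, its integral vanishes when the displacements
  agree.  The running cost of the competitor is represented by an integrable majorant \<open>\<phi>\<close>; in the
  set-valued problem \<open>\<phi>\<close> is a scalarized selection.\<close>

lemma running_cost_le:
  assumes v: "v absolutely_integrable_on {t..T}" and \<phi>: "\<phi> absolutely_integrable_on {t..T}"
    and le: "AE s in lebesgue_on {t..T}. \<delta> s * f (v s) \<le> \<phi> s"
    and same: "integral {t..T} v = displacement p"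
  shows "running_cost p \<le> integral {t..T} \<phi>"
proof -
  define \<psi> where "\<psi> s = \<delta> s * f (velocity p s) + p \<bullet> (v s - velocity p s)" for s
  have vel: "velocity p absolutely_integrable_on {t..T}"
    by (intro absolutely_integrable_continuous_real continuous_velocity)
  have cost: "(\<lambda>s. \<delta> s * f (velocity p s)) absolutely_integrable_on {t..T}"
    by (intro absolutely_integrable_continuous_real continuous_cost_density)
  have diff: "(\<lambda>s. v s - velocity p s) absolutely_integrable_on {t..T}"
    by (intro set_integral_diff v vel)
  have inn: "(\<lambda>s. p \<bullet> (v s - velocity p s)) absolutely_integrable_on {t..T}"
    using absolutely_integrable_linear[OF diff bounded_linear_inner_right[of p]] by (simp add: o_def)
  have int: "integral {t..T} (\<lambda>s. p \<bullet> (v s - velocity p s)) = p \<bullet> integral {t..T} (\<lambda>s. v s - velocity p s)"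
    using integral_linear[OF _ bounded_linear_inner_right[of p], of "\<lambda>s. v s - velocity p s"] diff
    by (simp add: o_def absolutely_integrable_on_def)
  also have "integral {t..T} (\<lambda>s. v s - velocity p s) = 0"
    using v vel same by (subst integral_diff) (auto simp: absolutely_integrable_on_def displacement_def)
  finally have "integral {t..T} \<psi> = running_cost p"
    using cost inn unfolding \<psi>_def[abs_def]
    by (subst integral_add) (auto simp: absolutely_integrable_on_def running_cost_def)
  moreover have "integral {t..T} \<psi> \<le> integral {t..T} \<phi>"
  proof (rule integral_le_AE[OF _ \<phi>])
    show "\<psi> absolutely_integrable_on {t..T}"
      unfolding \<psi>_def[abs_def] by (intro set_integral_add cost inn)
    have "AE s in lebesgue_on {t..T}. s \<in> {t..T}"
      using AE_space[of "lebesgue_on {t..T}"] by simp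
    with le show "AE s in lebesgue_on {t..T}. \<psi> s \<le> \<phi> s"
    proof eventually_elim
      case (elim s)
      define q where "q = p /\<^sub>R \<delta> s"
      have \<delta>: "0 < \<delta> s" using \<delta>_pos elim by auto
      have p: "p = \<delta> s *\<^sub>R q" using \<delta> by (simp add: q_def)
      have "\<psi> s = \<delta> s * (f (grad_inv q) + q \<bullet> (v s - grad_inv q))"
        unfolding \<psi>_def velocity_def q_def[symmetric] by (simp add: p distrib_left)
      also have "\<dots> \<le> \<delta> s * f (v s)"
        using grad_inv_above_tangent[of q "v s"] \<delta> by (intro mult_left_mono) auto
      finally show ?case using elim by simp
    qed
  qed
  ultimately show ?thesis by simp
qed

text \<open>The path length dominates the displacement, whose component along \<open>p\<close> grows without bound.\<close>

lemma path_length_at_top: "filterlim (\<lambda>p. integral {t..T} (\<lambda>s. norm (velocity p s))) at_top at_infinity"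
  unfolding filterlim_at_top eventually_at_infinity
proof
  fix Z :: real
  obtain c where c: "\<And>p. (\<bar>Z\<bar> + 1) * norm p - c \<le> p \<bullet> displacement p"
    using displacement_coercive[of "\<bar>Z\<bar> + 1"] by auto
  \<comment> \<open>Slope \<open>\<bar>Z\<bar> + 1\<close> leaves room to absorb the constant: \<open>c \<le> \<bar>p\<bar>\<close> once \<open>\<bar>p\<bar> \<ge> \<bar>c\<bar> + 1\<close>.\<close>
  have "Z \<le> integral {t..T} (\<lambda>s. norm (velocity p s))" if p: "\<bar>c\<bar> + 1 \<le> norm p" for p
  proof -
    have "norm (displacement p) \<le> integral {t..T} (\<lambda>s. norm (velocity p s))"
      unfolding displacement_def
      by (rule integral_norm_bound_integral)
         (auto intro!: integrable_continuous_real continuous_intros continuous_velocity)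
    moreover have "p \<bullet> displacement p \<le> norm p * norm (displacement p)" by (rule norm_cauchy_schwarz)
    ultimately have "p \<bullet> displacement p \<le> norm p * integral {t..T} (\<lambda>s. norm (velocity p s))"
      by (meson mult_left_mono norm_ge_zero order_trans)
    then have "(\<bar>Z\<bar> + 1) * norm p - c \<le> norm p * integral {t..T} (\<lambda>s. norm (velocity p s))"
      using c[of p] by linarith
    then have "norm p * \<bar>Z\<bar> \<le> norm p * integral {t..T} (\<lambda>s. norm (velocity p s))"
      using p by (simp add: algebra_simps)
    then have "\<bar>Z\<bar> \<le> integral {t..T} (\<lambda>s. norm (velocity p s))" using p by (subst (asm) mult_le_cancel_left_pos) auto
    then show ?thesis by simp
  qed
  then show "\<exists>b. \<forall>p. b \<le> norm p \<longrightarrow> Z \<le> integral {t..T} (\<lambda>s. norm (velocity p s))" by blast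
qed

text \<open>The running cost dominates \<open>K + 1\<close> times the path length up to a constant, while \<open>G\<close> can lose at most
  \<open>K\<close> times the displacement; one path length remains.\<close>

lemma total_cost_at_top:
  assumes G: "K-lipschitz_on UNIV G"
  shows "filterlim (\<lambda>p. G (displacement p) + running_cost p) at_top at_infinity"
proof -
  define len where "len p = integral {t..T} (\<lambda>s. norm (velocity p s))" for p
  have K: "0 \<le> K" using G by (rule lipschitz_on_nonneg)
  \<comment> \<open>The discount factor may shrink the growth rate of \<open>f\<close> by a factor \<open>a\<close>.\<close>
  define R where "R = (K + 1) / a"
  have R: "0 \<le> R" "a * R = K + 1" using K a_pos by (auto simp: R_def)
  obtain c where c: "\<And>w. R * norm w - c \<le> f w" using superlinear[of R] by blast
  have lower: "len p + (G 0 - (T - t) * \<bar>c\<bar>) \<le> G (displacement p) + running_cost p" for p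
  proof -
    have n: "(\<lambda>s. norm (velocity p s)) integrable_on {t..T}"
      by (intro integrable_continuous_real continuous_intros continuous_velocity)
    have "((\<lambda>s. (K + 1) * norm (velocity p s) - \<bar>c\<bar>) has_integral (K + 1) * len p - (T - t) * \<bar>c\<bar>) {t..T}"
      unfolding len_def using has_integral_const_real[of "\<bar>c\<bar>" t T] tT
      by (intro has_integral_diff has_integral_mult_right integrable_integral n) simp
    moreover have "((\<lambda>s. \<delta> s * f (velocity p s)) has_integral running_cost p) {t..T}"
      unfolding running_cost_def
      by (intro integrable_integral integrable_continuous_real continuous_cost_density)
    ultimately have 1: "(K + 1) * len p - (T - t) * \<bar>c\<bar> \<le> running_cost p"
    proof (rule has_integral_le)
      fix s assume s: "s \<in> {t..T}"
      define n where "n = norm (velocity p s)"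
      have \<delta>: "0 < \<delta> s" "a \<le> \<delta> s" "\<delta> s \<le> 1" using \<delta>_pos \<delta>_bounds s by (auto simp: less_imp_le)
      have "\<delta> s * c \<le> \<bar>c\<bar>" by (rule \<delta>_mult_le[OF s])
      moreover have "a * (R * n) \<le> \<delta> s * (R * n)" using \<delta> R by (intro mult_right_mono) (auto simp: n_def)
      moreover have "a * (R * n) = (K + 1) * n" using R(2) by (metis mult.assoc)
      ultimately have "(K + 1) * n - \<bar>c\<bar> \<le> \<delta> s * (R * n - c)" by (simp add: algebra_simps)
      also have "\<dots> \<le> \<delta> s * f (velocity p s)"
        using c[of "velocity p s"] \<delta> unfolding n_def by (intro mult_left_mono) auto
      finally show "(K + 1) * norm (velocity p s) - \<bar>c\<bar> \<le> \<delta> s * f (velocity p s)" by (simp add: n_def)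
    qed
    have "\<bar>G (displacement p) - G 0\<bar> \<le> K * norm (displacement p)"
      using lipschitz_onD[OF G, of "displacement p" 0] by (simp add: dist_norm)
    moreover have "norm (displacement p) \<le> len p"
      unfolding displacement_def len_def
      by (rule integral_norm_bound_integral)
         (auto intro!: integrable_continuous_real continuous_intros continuous_velocity)
    then have "K * norm (displacement p) \<le> K * len p" using K by (rule mult_left_mono)
    ultimately show ?thesis using 1 by (simp add: algebra_simps)
  qed
  have "filterlim (\<lambda>p. (G 0 - (T - t) * \<bar>c\<bar>) + len p) at_top at_infinity"
    by (rule filterlim_tendsto_add_at_top[OF tendsto_const]) (unfold len_def, rule path_length_at_top)
  then show ?thesis
    by (rule filterlim_at_top_mono) (intro always_eventually allI, use lower in \<open>simp add: add.commute\<close>)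
qed

text \<open>By \<open>surj_displacement\<close> and \<open>running_cost_le\<close> every competitor is beaten by the velocity of some
  costate, so that minimizing over costates suffices.\<close>

theorem optimal_costate:
  assumes G: "K-lipschitz_on UNIV G"
  shows "\<exists>p. \<forall>v \<phi>. v absolutely_integrable_on {t..T} \<longrightarrow> \<phi> absolutely_integrable_on {t..T} \<longrightarrow>
      (AE s in lebesgue_on {t..T}. \<delta> s * f (v s) \<le> \<phi> s) \<longrightarrow>
      G (displacement p) + running_cost p \<le> G (integral {t..T} v) + integral {t..T} \<phi>"
proof -
  have "continuous_on UNIV (\<lambda>p. G (displacement p) + running_cost p)"
    using continuous_on_compose2[OF lipschitz_on_continuous_on[OF G] continuous_displacement]
    by (intro continuous_intros continuous_running_cost) simp
  then obtain p where p: "\<And>q. G (displacement p) + running_cost p \<le> G (displacement q) + running_cost q"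
    using attains_min_of_at_top[OF _ total_cost_at_top[OF G]] by blast
  have "G (displacement p) + running_cost p \<le> G (integral {t..T} v) + integral {t..T} \<phi>"
    if "v absolutely_integrable_on {t..T}" "\<phi> absolutely_integrable_on {t..T}"
      "AE s in lebesgue_on {t..T}. \<delta> s * f (v s) \<le> \<phi> s" for v \<phi>
  proof -
    obtain q where q: "displacement q = integral {t..T} v" using surj_displacement by blast
    show ?thesis using p[of q] running_cost_le[OF that q[symmetric]] q by simp
  qed
  then show ?thesis by blast
qed

end

section \<open>Cones and their duals\<close>

lemma mem_translation_iff: "z \<in> v +o B \<longleftrightarrow> z - v \<in> B" for z v :: "'a::ab_group_add"
  unfolding elt_set_plus_def by (auto intro: bexI[of _ "z - v"])

text \<open>A functional that separates a point from \<open>S\<close> is bounded below on \<open>S\<close>.  It is nonnegative on \<open>C\<close>, as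
  otherwise moving inside \<open>S\<close> in a direction of \<open>C\<close> would drive it to the separating value.\<close>

lemma separate_from_upper_set:
  fixes S C :: "'a::euclidean_space set"
  assumes S: "convex S" "closed S" "S \<noteq> {}" and C: "cone C"
    and up: "\<And>s c. s \<in> S \<Longrightarrow> c \<in> C \<Longrightarrow> s + c \<in> S" and z: "z \<notin> S"
  shows "\<exists>\<zeta>\<in>dual_cone C - {0}. \<forall>s\<in>S. \<zeta> \<bullet> z < \<zeta> \<bullet> s"
proof -
  obtain \<zeta> b where b: "\<zeta> \<bullet> z < b" "\<And>s. s \<in> S \<Longrightarrow> b < \<zeta> \<bullet> s"
    using separating_hyperplane_closed_point[OF S(1,2) z] by blast
  obtain s0 where s0: "s0 \<in> S" using S(3) by blast
  have "\<zeta> \<noteq> 0" using b(1) b(2)[OF s0] by auto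
  moreover have "0 \<le> \<zeta> \<bullet> c" if c: "c \<in> C" for c
  proof (rule ccontr)
    assume neg: "\<not> 0 \<le> \<zeta> \<bullet> c"
    define r where "r = (b - \<zeta> \<bullet> s0) / (\<zeta> \<bullet> c)"
    have "0 \<le> r" using neg b(2)[OF s0] by (simp add: r_def divide_nonpos_neg)
    then have "s0 + r *\<^sub>R c \<in> S" using C c s0 by (intro up) (auto simp: cone_def)
    moreover have "\<zeta> \<bullet> (s0 + r *\<^sub>R c) = b" using neg by (simp add: r_def inner_add_right)
    ultimately show False using b(2) by force
  qed
  ultimately show ?thesis using b by (intro bexI[of _ \<zeta>]) (auto simp: dual_cone_def, force)
qed

text \<open>The bipolar theorem: a convex cone is stable under adding its own elements, so that a point outside
  is separated from it by a functional of the dual cone.\<close>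

lemma mem_cone_iff_dual_cone:
  fixes C :: "'a::euclidean_space set"
  assumes C: "closed C" "convex C" "cone C" "C \<noteq> {}"
  shows "z \<in> C \<longleftrightarrow> (\<forall>\<zeta>\<in>dual_cone C. 0 \<le> \<zeta> \<bullet> z)"
proof
  show "z \<in> C \<Longrightarrow> \<forall>\<zeta>\<in>dual_cone C. 0 \<le> \<zeta> \<bullet> z" by (simp add: dual_cone_def)
  assume pos: "\<forall>\<zeta>\<in>dual_cone C. 0 \<le> \<zeta> \<bullet> z"
  show "z \<in> C"
  proof (rule ccontr)
    assume "z \<notin> C"
    moreover have "s + c \<in> C" if "s \<in> C" "c \<in> C" for s c
      using C(2,3) that convex_cone by blast
    ultimately obtain \<zeta> where "\<zeta> \<in> dual_cone C" "\<And>s. s \<in> C \<Longrightarrow> \<zeta> \<bullet> z < \<zeta> \<bullet> s"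
      using separate_from_upper_set[of C C z] C by blast
    moreover have "0 \<in> C" using C(3,4) cone_contains_0 by blast
    ultimately show False using pos by force
  qed
qed

text \<open>Only the pairings of \<open>L\<close> with \<open>K\<close> are known to be continuous.  They determine the orthogonal
  projection of \<open>L\<close> onto the span of \<open>K\<close>, which is therefore continuous.\<close>

lemma continuous_representative_mod_annihilator:
  fixes L :: "'a::topological_space \<Rightarrow> 'b::euclidean_space"
  assumes "\<And>\<zeta>. \<zeta> \<in> K \<Longrightarrow> continuous_on UNIV (\<lambda>w. L w \<bullet> \<zeta>)"
  shows "\<exists>M. continuous_on UNIV M \<and> (\<forall>w. \<forall>\<zeta>\<in>K. M w \<bullet> \<zeta> = L w \<bullet> \<zeta>)"
proof -
  have cont: "continuous_on UNIV (\<lambda>w. L w \<bullet> \<zeta>)" if "\<zeta> \<in> span K" for \<zeta>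
    using that
  proof (induction rule: span_induct_alt)
    case base
    then show ?case by simp
  next
    case (step c x y)
    then show ?case using assms[of x]
      by (auto simp: inner_add_right intro!: continuous_intros)
  qed
  obtain E where E: "E \<subseteq> span K" "pairwise orthogonal E" "\<And>e. e \<in> E \<Longrightarrow> norm e = 1"
      "independent E" "span E = span K"
    using orthonormal_basis_subspace[OF subspace_span[of K]] by metis
  have fin: "finite E" using E(4) independent_imp_finite by blast
  define M where "M w = (\<Sum>e\<in>E. (L w \<bullet> e) *\<^sub>R e)" for w
  have "continuous_on UNIV M"
    unfolding M_def[abs_def] using E(1) by (intro continuous_intros cont) auto
  moreover have "M w \<bullet> \<zeta> = L w \<bullet> \<zeta>" if "\<zeta> \<in> K" for w \<zeta>
  proof -
    have "\<zeta> \<in> span E" using that E(5) by (simp add: span_base)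
    then have \<zeta>: "(\<Sum>e\<in>E. (\<zeta> \<bullet> e) *\<^sub>R e) = \<zeta>" using orthonormal_basis_expand E(2,3) fin by blast
    have "M w \<bullet> \<zeta> = (\<Sum>e\<in>E. (L w \<bullet> e) * (e \<bullet> \<zeta>))" by (simp add: M_def inner_sum_left)
    also have "\<dots> = L w \<bullet> (\<Sum>e\<in>E. (\<zeta> \<bullet> e) *\<^sub>R e)"
      by (simp add: inner_sum_right inner_commute mult.commute)
    finally show ?thesis by (simp only: \<zeta>)
  qed
  ultimately show ?thesis by blast
qed

section \<open>The set-valued problem\<close>

text \<open>Any weak derivative can take the place of the chosen one, as two of them agree almost everywhere.\<close>

lemma mem_Jfun_iff:
  assumes tT: "t < T" and v: "has_weak_deriv y v t T" and y: "continuous_on {t..T} y"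
  shows "z \<in> Jfun C T d L g t y \<longleftrightarrow>
    (\<exists>f. f absolutely_integrable_on {t..T} \<and> (AE s in lebesgue_on {t..T}. f s - d t s *\<^sub>R L (v s) \<in> C) \<and>
         z = d t T *\<^sub>R g (y T) + integral {t..T} f)"
proof -
  have "(AE s in lebesgue_on {t..T}. f s \<in> Lset C d L t s (weak_deriv t T y s))
      \<longleftrightarrow> (AE s in lebesgue_on {t..T}. f s - d t s *\<^sub>R L (v s) \<in> C)" for f
    using weak_deriv_AE_eq[OF v y] by (intro AE_cong_simp iffI; elim AE_mp)
      (auto simp: Lset_def mem_translation_iff)
  then show ?thesis
    using tT unfolding Jfun_def aumann_integral_def mem_translation_iff by (auto simp: algebra_simps)
qed

text \<open>The separating functionals that occur below are arbitrary nonzero elements of the dual cone, so the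
  hypotheses on \<open>L\<close> and \<open>g\<close> are stated for all of these; they pass from a base to the cone by
  scaling.\<close>

locale set_valued_problem =
  fixes C :: "'b::euclidean_space set" and T t a :: real and d :: "real \<Rightarrow> real \<Rightarrow> real"
    and L g :: "'a::euclidean_space \<Rightarrow> 'b" and x :: 'a
  assumes C: "closed C" "convex C" "cone C" "C \<noteq> {}"
    and tT: "t < T" and a_pos: "0 < a"
    and d_bounds: "\<And>s. s \<in> {t..T} \<Longrightarrow> a < d t s \<and> d t s \<le> 1"
    and d_cont: "continuous_on {t..T} (d t)"
    and L: "\<And>\<zeta>. \<zeta> \<in> dual_cone C - {0} \<Longrightarrow> legendre_function (scalarize L \<zeta>)"
    and g_lipschitz: "\<And>\<zeta>. \<zeta> \<in> dual_cone C - {0} \<Longrightarrow> \<exists>K. K-lipschitz_on UNIV (scalarize g \<zeta>)"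
    and g_convex: "\<And>\<zeta>. \<zeta> \<in> dual_cone C - {0} \<Longrightarrow> convex_on UNIV (scalarize g \<zeta>)"
begin

abbreviation J :: "(real \<Rightarrow> 'a) \<Rightarrow> 'b set" where "J \<equiv> Jfun C T d L g t"
abbreviation arcs :: "(real \<Rightarrow> 'a) set" where "arcs \<equiv> admissible T t x"

lemma d_pos: "s \<in> {t..T} \<Longrightarrow> 0 < d t s"
  using d_bounds a_pos by force

lemma mem_C_iff: "z \<in> C \<longleftrightarrow> (\<forall>\<zeta>\<in>dual_cone C - {0}. 0 \<le> \<zeta> \<bullet> z)"
  unfolding mem_cone_iff_dual_cone[OF C] by force

lemma L_convex:
  assumes "\<zeta> \<in> dual_cone C - {0}" "0 \<le> u" "u \<le> 1"
  shows "\<zeta> \<bullet> L ((1 - u) *\<^sub>R v + u *\<^sub>R w) \<le> (1 - u) * (\<zeta> \<bullet> L v) + u * (\<zeta> \<bullet> L w)"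
  using convex_onD[OF strictly_convex_imp_convex_on[OF legendre_function.strict[OF L[OF assms(1)]]],
      of u v w] assms(2,3)
  by (simp add: scalarize_def inner_commute)

lemma mem_arcsE:
  assumes "y \<in> arcs"
  obtains v where "has_weak_deriv y v t T" "continuous_on {t..T} y" "y t = x"
  using assms unfolding admissible_def W11_def by blast

lemma primitive_mem_arcs:
  assumes w: "continuous_on {t..T} w"
  shows "(\<lambda>s. x + integral {t..s} w) \<in> arcs"
  using has_weak_deriv_primitive[OF w, of x] tT
    indefinite_integral_continuous_1[OF integrable_continuous_real[OF w]]
  unfolding admissible_def W11_def by (auto intro!: continuous_intros)

text \<open>Spread \<open>c\<close> evenly over the interval and add it to the selection.\<close>

lemma J_upward:
  assumes "y \<in> arcs" "z \<in> J y" "c \<in> C"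
  shows "z + c \<in> J y"
proof -
  obtain v where v: "has_weak_deriv y v t T" "continuous_on {t..T} y" using assms(1) by (rule mem_arcsE)
  note J_iff = mem_Jfun_iff[OF tT v, of _ C d L g]
  obtain f where f: "f absolutely_integrable_on {t..T}"
      "AE s in lebesgue_on {t..T}. f s - d t s *\<^sub>R L (v s) \<in> C" "z = d t T *\<^sub>R g (y T) + integral {t..T} f"
    using assms(2) unfolding J_iff by blast
  define c' where "c' = c /\<^sub>R (T - t)"
  have c': "c' \<in> C" using C(3) assms(3) tT by (simp add: c'_def cone_def)
  have const: "(\<lambda>s. c') absolutely_integrable_on {t..T}"
    by (intro absolutely_integrable_continuous_real continuous_intros)
  have "(\<lambda>s. f s + c') absolutely_integrable_on {t..T}" by (intro set_integral_add f const)
  moreover have "AE s in lebesgue_on {t..T}. f s + c' - d t s *\<^sub>R L (v s) \<in> C"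
    using f(2)
  proof eventually_elim
    case (elim s)
    then have "(f s - d t s *\<^sub>R L (v s)) + c' \<in> C" using C(2,3) c' convex_cone by blast
    then show ?case by (simp add: algebra_simps)
  qed
  moreover have "integral {t..T} (\<lambda>s. f s + c') = integral {t..T} f + c"
    using f(1) const tT by (subst integral_add) (auto simp: absolutely_integrable_on_def c'_def)
  ultimately show ?thesis unfolding J_iff using f(3) by (intro exI[of _ "\<lambda>s. f s + c'"]) simp
qed

text \<open>For an arc with continuous velocity there is a continuous selection on which the constraint
  \<open>f \<in> d L(w) + C\<close> is an equality after pairing with the dual cone.  So all scalar costs are attained
  simultaneously by one point of \<open>J\<close>.\<close>

lemma J_primitive_point:
  assumes w: "continuous_on {t..T} w"
  shows "\<exists>z\<in>J (\<lambda>s. x + integral {t..s} w). \<forall>\<zeta>\<in>dual_cone C - {0}.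
      \<zeta> \<bullet> z = d t T * scalarize g \<zeta> (x + integral {t..T} w)
        + integral {t..T} (\<lambda>s. d t s * scalarize L \<zeta> (w s))"
proof -
  have "continuous_on UNIV (\<lambda>w. L w \<bullet> \<zeta>)" if "\<zeta> \<in> dual_cone C - {0}" for \<zeta>
    using legendre_function.continuous_f[OF L[OF that]] by (simp add: scalarize_def[abs_def])
  then obtain M where M: "continuous_on UNIV M"
      "\<And>w \<zeta>. \<zeta> \<in> dual_cone C - {0} \<Longrightarrow> M w \<bullet> \<zeta> = L w \<bullet> \<zeta>"
    using continuous_representative_mod_annihilator[of "dual_cone C - {0}" L] by metis
  define f where "f s = d t s *\<^sub>R M (w s)" for s
  have cf: "continuous_on {t..T} f"
    unfolding f_def[abs_def] using continuous_on_compose2[OF M(1) w] by (intro continuous_intros d_cont) auto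
  have "f s - d t s *\<^sub>R L (w s) \<in> C" for s
    unfolding mem_C_iff f_def using M(2)[of _ "w s"] by (simp add: inner_diff_right inner_commute)
  then have "d t T *\<^sub>R g (x + integral {t..T} w) + integral {t..T} f \<in> J (\<lambda>s. x + integral {t..s} w)"
    using absolutely_integrable_continuous_real[OF cf] tT
    by (subst mem_Jfun_iff[OF tT has_weak_deriv_primitive[OF w]])
       (auto intro!: exI[of _ f] continuous_intros indefinite_integral_continuous_1 integrable_continuous_real w)
  moreover have "\<zeta> \<bullet> integral {t..T} f = integral {t..T} (\<lambda>s. d t s * scalarize L \<zeta> (w s))"
    if "\<zeta> \<in> dual_cone C - {0}" for \<zeta>
  proof -
    have "\<zeta> \<bullet> integral {t..T} f = integral {t..T} (\<lambda>s. \<zeta> \<bullet> f s)"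
      using integral_linear[OF integrable_continuous_real[OF cf] bounded_linear_inner_right[of \<zeta>]]
      by (simp add: o_def)
    also have "(\<lambda>s. \<zeta> \<bullet> f s) = (\<lambda>s. d t s * scalarize L \<zeta> (w s))"
      using M(2)[OF that] by (simp add: f_def scalarize_def inner_commute)
    finally show ?thesis .
  qed
  ultimately show ?thesis
    by (intro bexI[of _ "d t T *\<^sub>R g (x + integral {t..T} w) + integral {t..T} f"])
       (simp_all add: inner_add_right scalarize_def inner_commute)
qed

text \<open>Pairing with \<open>\<zeta>\<close> turns a selection into an integrable majorant of the scalarized running cost; points
  of \<open>J y\<close> are thus competitors in the scalar problem.\<close>

lemma J_scalar_bound:
  assumes \<zeta>: "\<zeta> \<in> dual_cone C - {0}" and y: "y \<in> arcs" and z: "z \<in> J y"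
  shows "\<exists>v \<phi>. v absolutely_integrable_on {t..T} \<and> \<phi> absolutely_integrable_on {t..T} \<and>
     (AE s in lebesgue_on {t..T}. d t s * scalarize L \<zeta> (v s) \<le> \<phi> s) \<and>
     \<zeta> \<bullet> z = d t T * scalarize g \<zeta> (x + integral {t..T} v) + integral {t..T} \<phi>"
proof -
  obtain v where v: "has_weak_deriv y v t T" "continuous_on {t..T} y" "y t = x"
    using y by (rule mem_arcsE)
  obtain f where f: "f absolutely_integrable_on {t..T}"
      "AE s in lebesgue_on {t..T}. f s - d t s *\<^sub>R L (v s) \<in> C" "z = d t T *\<^sub>R g (y T) + integral {t..T} f"
    using z unfolding mem_Jfun_iff[OF tT v(1,2)] by blast
  have yT: "y T = x + integral {t..T} v"
    using has_weak_deriv_increment[OF v(1,2) tT] v(3) by simp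
  have "(\<lambda>s. \<zeta> \<bullet> f s) absolutely_integrable_on {t..T}"
    using absolutely_integrable_linear[OF f(1) bounded_linear_inner_right[of \<zeta>]] by (simp add: o_def)
  moreover have "AE s in lebesgue_on {t..T}. d t s * scalarize L \<zeta> (v s) \<le> \<zeta> \<bullet> f s"
    using f(2)
  proof eventually_elim
    case (elim s)
    then have "0 \<le> \<zeta> \<bullet> (f s - d t s *\<^sub>R L (v s))" using \<zeta> mem_C_iff by blast
    then show ?case by (simp add: inner_diff_right scalarize_def inner_commute)
  qed
  moreover have "integral {t..T} (\<lambda>s. \<zeta> \<bullet> f s) = \<zeta> \<bullet> integral {t..T} f"
    using integral_linear[OF _ bounded_linear_inner_right[of \<zeta>], of f] f(1)
    by (simp add: o_def absolutely_integrable_on_def)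
  ultimately show ?thesis
    using v(1) yT f(3)
    by (intro exI[of _ v] exI[of _ "\<lambda>s. \<zeta> \<bullet> f s"])
       (simp add: has_weak_deriv_def inner_add_right scalarize_def inner_commute)
qed

lemma Yarc_mem_arcs:
  assumes "\<zeta> \<in> dual_cone C - {0}"
  shows "Yarc d L t x p \<zeta> \<in> arcs"
proof -
  interpret P: discounted_problem "scalarize L \<zeta>" "d t" a t T
    using L[OF assms] tT a_pos d_bounds d_cont
    by (simp add: discounted_problem_def discounted_problem_axioms_def)
  show ?thesis
    using primitive_mem_arcs[OF P.continuous_velocity[of p]]
    unfolding Yarc_def[abs_def] P.velocity_def[abs_def] .
qed

text \<open>The optimal costate of the scalar problem yields a point of \<open>U\<close> through which the supporting
  hyperplane with normal \<open>\<zeta>\<close> passes.\<close>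

lemma Yarc_point_minimal:
  assumes \<zeta>: "\<zeta> \<in> dual_cone C - {0}"
  shows "\<exists>p. \<exists>z0\<in>J (Yarc d L t x p \<zeta>). \<forall>y\<in>arcs. \<forall>z\<in>J y. \<zeta> \<bullet> z0 \<le> \<zeta> \<bullet> z"
proof -
  interpret P: discounted_problem "scalarize L \<zeta>" "d t" a t T
    using L[OF \<zeta>] tT a_pos d_bounds d_cont
    by (simp add: discounted_problem_def discounted_problem_axioms_def)
  define G where "G e = d t T * scalarize g \<zeta> (x + e)" for e
  obtain K where K: "K-lipschitz_on UNIV (scalarize g \<zeta>)" using g_lipschitz[OF \<zeta>] by blast
  have dT: "0 < d t T" using d_pos tT by simp
  have "(d t T * K)-lipschitz_on UNIV G"
  proof (rule lipschitz_onI)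
    show "0 \<le> d t T * K" using dT lipschitz_on_nonneg[OF K] by simp
    show "dist (G e) (G e') \<le> d t T * K * dist e e'" for e e'
    proof -
      have "dist (G e) (G e') = d t T * dist (scalarize g \<zeta> (x + e)) (scalarize g \<zeta> (x + e'))"
        using dT by (simp add: G_def dist_real_def abs_mult flip: right_diff_distrib)
      also have "\<dots> \<le> d t T * (K * dist (x + e) (x + e'))"
        using dT lipschitz_onD[OF K, of "x + e" "x + e'"] by (intro mult_left_mono) auto
      finally show ?thesis by simp
    qed
  qed
  from P.optimal_costate[OF this] obtain p where
    p: "\<And>v \<phi>. v absolutely_integrable_on {t..T} \<Longrightarrow> \<phi> absolutely_integrable_on {t..T} \<Longrightarrow>
      AE s in lebesgue_on {t..T}. d t s * scalarize L \<zeta> (v s) \<le> \<phi> s \<Longrightarrow>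
      G (P.displacement p) + P.running_cost p \<le> G (integral {t..T} v) + integral {t..T} \<phi>"
    by blast
  obtain z0 where z0: "z0 \<in> J (\<lambda>s. x + integral {t..s} (P.velocity p))"
    and val: "\<zeta> \<bullet> z0 = d t T * scalarize g \<zeta> (x + integral {t..T} (P.velocity p))
        + integral {t..T} (\<lambda>s. d t s * scalarize L \<zeta> (P.velocity p s))"
    using J_primitive_point[OF P.continuous_velocity[of p]] \<zeta> by blast
  have "\<zeta> \<bullet> z0 = G (P.displacement p) + P.running_cost p"
    unfolding val G_def P.displacement_def P.running_cost_def ..
  moreover have "\<zeta> \<bullet> z0 \<le> \<zeta> \<bullet> z" if y: "y \<in> arcs" and z: "z \<in> J y" for y z
    using J_scalar_bound[OF \<zeta> y z] p calculation unfolding G_def by force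
  moreover have "(\<lambda>s. x + integral {t..s} (P.velocity p)) = Yarc d L t x p \<zeta>"
    unfolding Yarc_def[abs_def] P.velocity_def[abs_def] ..
  ultimately show ?thesis using z0 by metis
qed

text \<open>Combine arcs and selections convexly.  Convexity of the scalarizations of \<open>L\<close> keeps the combined
  selection admissible, by the bipolar theorem; the gap between the combination of the terminal costs
  and the terminal cost of the combined arc lies in \<open>C\<close> since \<open>g\<close> is convex, and \<open>J_upward\<close> absorbs it.\<close>

lemma convex_Union_J: "convex (\<Union>y\<in>arcs. J y)"
  unfolding convex_alt
proof (intro ballI allI impI)
  fix z1 z2 and u :: real
  assume "z1 \<in> (\<Union>y\<in>arcs. J y)" "z2 \<in> (\<Union>y\<in>arcs. J y)" and u: "0 \<le> u \<and> u \<le> 1"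
  then obtain y1 y2 where y: "y1 \<in> arcs" "y2 \<in> arcs" and z: "z1 \<in> J y1" "z2 \<in> J y2" by blast
  obtain v1 where v1: "has_weak_deriv y1 v1 t T" "continuous_on {t..T} y1" "y1 t = x"
    using y(1) by (rule mem_arcsE)
  obtain v2 where v2: "has_weak_deriv y2 v2 t T" "continuous_on {t..T} y2" "y2 t = x"
    using y(2) by (rule mem_arcsE)
  obtain f1 where f1: "f1 absolutely_integrable_on {t..T}"
      "AE s in lebesgue_on {t..T}. f1 s - d t s *\<^sub>R L (v1 s) \<in> C" "z1 = d t T *\<^sub>R g (y1 T) + integral {t..T} f1"
    using z(1) unfolding mem_Jfun_iff[OF tT v1(1,2)] by blast
  obtain f2 where f2: "f2 absolutely_integrable_on {t..T}"
      "AE s in lebesgue_on {t..T}. f2 s - d t s *\<^sub>R L (v2 s) \<in> C" "z2 = d t T *\<^sub>R g (y2 T) + integral {t..T} f2"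
    using z(2) unfolding mem_Jfun_iff[OF tT v2(1,2)] by blast
  define y v f where "y s = (1 - u) *\<^sub>R y1 s + u *\<^sub>R y2 s" and "v s = (1 - u) *\<^sub>R v1 s + u *\<^sub>R v2 s"
    and "f s = (1 - u) *\<^sub>R f1 s + u *\<^sub>R f2 s" for s
  have yv: "has_weak_deriv y v t T"
    unfolding y_def[abs_def] v_def[abs_def] by (intro has_weak_deriv_convex_combination v1 v2)
  have cy: "continuous_on {t..T} y" unfolding y_def[abs_def] by (intro continuous_intros v1 v2)
  have y: "y \<in> arcs"
    using yv cy v1(3) v2(3) unfolding admissible_def W11_def
    by (auto simp: y_def algebra_simps)
  have f: "f absolutely_integrable_on {t..T}"
    unfolding f_def[abs_def]
    by (intro set_integral_add absolutely_integrable_continuous_scaleR continuous_on_const f1 f2)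
  have intf: "integral {t..T} f = (1 - u) *\<^sub>R integral {t..T} f1 + u *\<^sub>R integral {t..T} f2"
    unfolding f_def[abs_def] using f1(1) f2(1)
    by (intro integral_unique has_integral_add has_integral_cmul integrable_integral)
       (auto simp: absolutely_integrable_on_def)
  have "AE s in lebesgue_on {t..T}. s \<in> {t..T}"
    using AE_space[of "lebesgue_on {t..T}"] by simp
  with f1(2) f2(2) have "AE s in lebesgue_on {t..T}. f s - d t s *\<^sub>R L (v s) \<in> C"
  proof eventually_elim
    case (elim s)
    show ?case unfolding mem_C_iff
    proof
      fix \<zeta> assume \<zeta>: "\<zeta> \<in> dual_cone C - {0}"
      have "d t s * (\<zeta> \<bullet> L (v s)) \<le> d t s * ((1 - u) * (\<zeta> \<bullet> L (v1 s)) + u * (\<zeta> \<bullet> L (v2 s)))"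
        using L_convex[OF \<zeta>] u d_pos[of s] elim unfolding v_def by (intro mult_left_mono) auto
      also have "\<dots> = (1 - u) * (d t s * (\<zeta> \<bullet> L (v1 s))) + u * (d t s * (\<zeta> \<bullet> L (v2 s)))"
        by (simp add: algebra_simps)
      also have "\<dots> \<le> (1 - u) * (\<zeta> \<bullet> f1 s) + u * (\<zeta> \<bullet> f2 s)"
        using elim \<zeta> u unfolding mem_C_iff
        by (intro add_mono mult_left_mono) (auto simp: inner_diff_right)
      finally show "0 \<le> \<zeta> \<bullet> (f s - d t s *\<^sub>R L (v s))"
        by (simp add: f_def inner_diff_right inner_add_right)
    qed
  qed
  with f have "d t T *\<^sub>R g (y T) + integral {t..T} f \<in> J y"
    unfolding mem_Jfun_iff[OF tT yv cy] by blast
  moreover have "d t T *\<^sub>R ((1 - u) *\<^sub>R g (y1 T) + u *\<^sub>R g (y2 T) - g (y T)) \<in> C"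
    unfolding mem_C_iff
  proof
    fix \<zeta> assume \<zeta>: "\<zeta> \<in> dual_cone C - {0}"
    have "\<zeta> \<bullet> g (y T) \<le> (1 - u) * (\<zeta> \<bullet> g (y1 T)) + u * (\<zeta> \<bullet> g (y2 T))"
      using convex_onD[OF g_convex[OF \<zeta>], of u "y1 T" "y2 T"] u
      by (simp add: y_def scalarize_def inner_commute)
    then show "0 \<le> \<zeta> \<bullet> (d t T *\<^sub>R ((1 - u) *\<^sub>R g (y1 T) + u *\<^sub>R g (y2 T) - g (y T)))"
      using d_pos[of T] tT by (simp add: inner_diff_right inner_add_right)
  qed
  ultimately have "d t T *\<^sub>R g (y T) + integral {t..T} f
      + d t T *\<^sub>R ((1 - u) *\<^sub>R g (y1 T) + u *\<^sub>R g (y2 T) - g (y T)) \<in> J y"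
    using J_upward[OF y] by blast
  also have "d t T *\<^sub>R g (y T) + integral {t..T} f
      + d t T *\<^sub>R ((1 - u) *\<^sub>R g (y1 T) + u *\<^sub>R g (y2 T) - g (y T)) = (1 - u) *\<^sub>R z1 + u *\<^sub>R z2"
    by (simp add: intf f1(3) f2(3) algebra_simps)
  finally show "(1 - u) *\<^sub>R z1 + u *\<^sub>R z2 \<in> (\<Union>y\<in>arcs. J y)" using y by blast
qed

theorem value_function_eq:
  "value_function C T d L g t x =
     Fsup ((\<lambda>\<zeta>. Finf (range (\<lambda>p. J (Yarc d L t x p \<zeta>))) + Hplus \<zeta>) ` (dual_cone C - {0}))"
proof -
  define S where "S = (\<Union>y\<in>arcs. J y)"
  define N where "N \<zeta> = (\<Union>p. J (Yarc d L t x p \<zeta>))" for \<zeta>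
  have N: "N \<zeta> \<subseteq> S" if "\<zeta> \<in> dual_cone C - {0}" for \<zeta>
    using Yarc_mem_arcs[OF that] by (auto simp: N_def S_def)
  have "closure S = (\<Inter>\<zeta>\<in>dual_cone C - {0}. closure (N \<zeta>) + Hplus \<zeta>)"
  proof (intro equalityI subsetI INT_I)
    fix z \<zeta> assume z: "z \<in> closure S" and \<zeta>: "\<zeta> \<in> dual_cone C - {0}"
    obtain p z0 where z0: "z0 \<in> J (Yarc d L t x p \<zeta>)" "\<And>z. z \<in> S \<Longrightarrow> \<zeta> \<bullet> z0 \<le> \<zeta> \<bullet> z"
      using Yarc_point_minimal[OF \<zeta>] unfolding S_def by blast
    have "closure S \<subseteq> {z. \<zeta> \<bullet> z0 \<le> \<zeta> \<bullet> z}"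
      using z0(2) by (intro closure_minimal closed_halfspace_ge) auto
    then have "z - z0 \<in> Hplus \<zeta>" using z by (auto simp: Hplus_def inner_diff_right)
    moreover have "z0 \<in> closure (N \<zeta>)"
      using z0(1) by (intro subsetD[OF closure_subset]) (auto simp: N_def)
    ultimately show "z \<in> closure (N \<zeta>) + Hplus \<zeta>"
      using set_plus_intro[of z0 "closure (N \<zeta>)" "z - z0" "Hplus \<zeta>"] by simp
  next
    fix z assume z: "z \<in> (\<Inter>\<zeta>\<in>dual_cone C - {0}. closure (N \<zeta>) + Hplus \<zeta>)"
    show "z \<in> closure S"
    proof (rule ccontr)
      assume "z \<notin> closure S"
      moreover have "convex (closure S)" unfolding S_def by (intro convex_closure convex_Union_J)
      moreover have "closure S \<noteq> {}"
      proof -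
        have "continuous_on {t..T} (\<lambda>_. 0 :: 'a)" by (rule continuous_on_const)
        then show ?thesis
          using J_primitive_point primitive_mem_arcs unfolding S_def closure_eq_empty by blast
      qed
      moreover have "s + c \<in> closure S" if "s \<in> closure S" "c \<in> C" for s c
      proof -
        have "s + c \<in> (\<lambda>s. s + c) ` closure S" using that by blast
        also have "\<dots> \<subseteq> closure S"
        proof (rule image_closure_subset)
          have "(\<lambda>s. s + c) ` S \<subseteq> S" using J_upward[OF _ _ that(2)] by (auto simp: S_def)
          then show "(\<lambda>s. s + c) ` S \<subseteq> closure S" using closure_subset by blast
        qed (auto intro!: continuous_intros)
        finally show ?thesis .
      qed
      ultimately obtain \<zeta> where \<zeta>: "\<zeta> \<in> dual_cone C - {0}" "\<And>s. s \<in> closure S \<Longrightarrow> \<zeta> \<bullet> z < \<zeta> \<bullet> s"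
        using separate_from_upper_set[of "closure S" C z] C(3) by blast
      have "z \<in> closure (N \<zeta>) + Hplus \<zeta>" using z \<zeta>(1) by blast
      then obtain s h where "z = s + h" "s \<in> closure (N \<zeta>)" "h \<in> Hplus \<zeta>"
        by (rule set_plus_elim)
      then show False
        using \<zeta>(2)[of s] closure_mono[OF N[OF \<zeta>(1)]] by (auto simp: Hplus_def inner_add_right)
    qed
  qed
  then show ?thesis
    unfolding value_function_def Finf_def Fsup_def S_def N_def by simp
qed

end

theorem theorem5p3:
  fixes C :: "(real ^ 'd) set"
    and B :: "(real ^ 'd) set"
    and L g :: "real ^ 'n \<Rightarrow> real ^ 'd"
    and d :: "real \<Rightarrow> real \<Rightarrow> real"
    and T a t :: real
    and x :: "real ^ 'n"
  assumes cone_C: "closed C" "convex C" "cone C" "interior C \<noteq> {}"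
    and T_pos: "0 < T"
    and base: "is_cone_base B (dual_cone C)"
    and h1: "\<And>\<zeta>. \<zeta> \<in> B \<Longrightarrow> C2_function (scalarize L \<zeta>) \<and>
               strictly_convex (scalarize L \<zeta>) \<and> coercive (scalarize L \<zeta>)"
    and h2: "\<And>\<zeta>. \<zeta> \<in> B \<Longrightarrow> \<exists>K. K-lipschitz_on UNIV (scalarize g \<zeta>)"
    and h3: "a > 0"
            "\<And>r. r \<in> {0..T} \<Longrightarrow> d r ` {r..T} \<subseteq> {a<..1} \<and> continuous_on {r..T} (d r) \<and> d r r = 1"
    and g_convex: "\<And>\<zeta>. \<zeta> \<in> B \<Longrightarrow> convex_on UNIV (scalarize g \<zeta>)"
    and t: "0 \<le> t" "t < T"
  shows "value_function C T d L g t x =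
           Fsup ((\<lambda>\<zeta>. Finf (range (\<lambda>p. Jfun C T d L g t (Yarc d L t x p \<zeta>))) + Hplus \<zeta>)
                   ` (dual_cone C - {0}))"
proof -
  have scale: "\<exists>l \<xi>. 0 < l \<and> \<xi> \<in> B \<and> scalarize L \<zeta> = (\<lambda>w. l * scalarize L \<xi> w)
      \<and> scalarize g \<zeta> = (\<lambda>w. l * scalarize g \<xi> w)" if \<zeta>: "\<zeta> \<in> dual_cone C - {0}" for \<zeta>
  proof -
    obtain l \<xi> where "0 < l" "\<xi> \<in> B" "\<zeta> = l *\<^sub>R \<xi>"
      using base \<zeta> unfolding is_cone_base_def by blast
    then show ?thesis by (intro exI[of _ l] exI[of _ \<xi>]) (auto simp: scalarize_def[abs_def])
  qed
  have "set_valued_problem C T t a d L g"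
  proof (rule set_valued_problem.intro)
    show "closed C" "convex C" "cone C" "t < T" "0 < a" by fact+
    show "C \<noteq> {}" using cone_C(4) by auto
    show "a < d t s \<and> d t s \<le> 1" if "s \<in> {t..T}" for s
      using h3(2)[of t] t that by (auto simp: image_subset_iff)
    show "continuous_on {t..T} (d t)" using h3(2)[of t] t by auto
    fix \<zeta> assume "\<zeta> \<in> dual_cone C - {0}"
    then obtain l \<xi> where l: "0 < l" and \<xi>: "\<xi> \<in> B"
      and eqL: "scalarize L \<zeta> = (\<lambda>w. l * scalarize L \<xi> w)"
      and eqg: "scalarize g \<zeta> = (\<lambda>w. l * scalarize g \<xi> w)" using scale by blast
    show "legendre_function (scalarize L \<zeta>)"
      unfolding eqL using h1[OF \<xi>] l legendre_function_scale by blast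
    obtain K where "K-lipschitz_on UNIV (scalarize g \<xi>)" using h2[OF \<xi>] by blast
    from lipschitz_on_cmult_real[OF this, of l] show "\<exists>K. K-lipschitz_on UNIV (scalarize g \<zeta>)"
      unfolding eqg by blast
    show "convex_on UNIV (scalarize g \<zeta>)"
      unfolding eqg using g_convex[OF \<xi>] l by (intro convex_on_cmul) auto
  qed
  then show ?thesis by (rule set_valued_problem.value_function_eq)
qed

end
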